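(* There exists a universal constant $c>0$ such that for every $n\ge 1$ and all increasing functions $f,g:\{-1,1\}^n\to\{0,1\}$ such that $g$ is antipodal, $$ \mathrm{Cor}(f,g)\ \ge\ c\,\frac{\sum_{i=1}^n \mathrm{I}_i(f)\,\mathrm{I}_i(g)}{\sqrt{\log\left(\frac{2e}{\sum_{i=1}^n \mathrm{I}_i(f)\,\mathrm{I}_i(g)}\right)}}. $$
   Context: Let $\mu$ be the uniform probability measure on $\{-1,1\}^n$ and $\mathbb{E}$ the expectation with respect to $\mu$. For $f:\{-1,1\}^n\to\{0,1\}$ and $i\in\{1,\dots,n\}$, the discrete derivative is $\partial_i f(x)=f(x;x_i\to 1)-f(x;x_i\to -1)$, where $(x;x_i\to a)$ denotes $x$ with its $i$-th coordinate replaced by $a$. The function $f$ is increasing if $\partial_i f(x)\ge 0$ for all $i$ and all $x$. The influence of the $i$-th coordinate is $\mathrm{I}_i(f)=2\int|\partial_i f(x)|\,d\mu(x)$. The correlation is $\mathrm{Cor}(f,g)=\mathbb{E}[fg]-\mathbb{E}[f]\,\mathbb{E}[g]$. The function $g$ is antipodal if $g(x)=1-g(-x)$ for all $x\in\{-1,1\}^n$. Here $\log$ is the natural logarithm, and the right-hand side is interpreted as $0$ when $\sum_i \mathrm{I}_i(f)\mathrm{I}_i(g)=0$. The constant $c$ does not depend on $n,f,g$. *)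

theory Defs
  imports "HOL-Probability.Probability"
begin

text \<open>Points of the cube are extensional functions on \<open>{1..n}\<close>: outside this index set they take
  the value \<^term>\<open>undefined\<close>, so that the cube has exactly \<open>2 ^ n\<close> elements.\<close>

definition cube :: "nat \<Rightarrow> (nat \<Rightarrow> int) set" where
  "cube n = {1..n} \<rightarrow>\<^sub>E {-1, 1}"

definition cube_measure :: "nat \<Rightarrow> (nat \<Rightarrow> int) pmf" where
  "cube_measure n = pmf_of_set (cube n)"

abbreviation cube_expectation :: "nat \<Rightarrow> ((nat \<Rightarrow> int) \<Rightarrow> real) \<Rightarrow> real" where
  "cube_expectation n \<equiv> measure_pmf.expectation (cube_measure n)"

definition discrete_deriv :: "nat \<Rightarrow> ((nat \<Rightarrow> int) \<Rightarrow> real) \<Rightarrow> (nat \<Rightarrow> int) \<Rightarrow> real" where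
  "discrete_deriv i f x = f (x(i := 1)) - f (x(i := -1))"

definition cube_increasing :: "nat \<Rightarrow> ((nat \<Rightarrow> int) \<Rightarrow> real) \<Rightarrow> bool" where
  "cube_increasing n f \<longleftrightarrow> (\<forall>i\<in>{1..n}. \<forall>x\<in>cube n. discrete_deriv i f x \<ge> 0)"

definition influence :: "nat \<Rightarrow> nat \<Rightarrow> ((nat \<Rightarrow> int) \<Rightarrow> real) \<Rightarrow> real" where
  "influence n i f = 2 * cube_expectation n (\<lambda>x. \<bar>discrete_deriv i f x\<bar>)"

definition Cor :: "nat \<Rightarrow> ((nat \<Rightarrow> int) \<Rightarrow> real) \<Rightarrow> ((nat \<Rightarrow> int) \<Rightarrow> real) \<Rightarrow> real" where
  "Cor n f g = cube_expectation n (\<lambda>x. f x * g x) - cube_expectation n f * cube_expectation n g"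

text \<open>The restriction keeps the antipode \<open>-x\<close> extensional, hence in the cube.\<close>

definition antipode :: "nat \<Rightarrow> (nat \<Rightarrow> int) \<Rightarrow> nat \<Rightarrow> int" where
  "antipode n x = (\<lambda>i\<in>{1..n}. - x i)"

definition antipodal :: "nat \<Rightarrow> ((nat \<Rightarrow> int) \<Rightarrow> real) \<Rightarrow> bool" where
  "antipodal n g \<longleftrightarrow> (\<forall>x\<in>cube n. g x = 1 - g (antipode n x))"

end

theory Submission
  imports Defs
begin

text \<open>
Let \<open>q(\<rho>) = \<Sum>\<^sub>S \<rho>\<^bsup>|S|\<^esup> F(S) G(S)\<close>, where \<open>F\<close>, \<open>G\<close> are the Fourier-Walsh coefficients of \<open>f\<close>, \<open>g\<close>,
so that the correlation is \<open>q(1) - q(0)\<close>. Monotonicity gives \<open>q' \<ge> 0\<close>; moreover \<open>q'(0) = W\<close> is one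
sixteenth of the sum of the products of influences, and \<open>q''(0) = 0\<close> because \<open>g\<close> is antipodal.
The crux is \<open>q''' \<ge> - K (q' + W)\<close> on \<open>[0, 1/2]\<close> with \<open>K\<close> of order \<open>log (e / W)\<close>: a Sturm comparison
with \<open>1 - K \<rho>\<^sup>2\<close> then keeps \<open>q' \<ge> W / 2\<close> up to \<open>\<rho>\<close> of order \<open>1 / sqrt K\<close>, whence
\<open>q(1) - q(0)\<close> is at least of order \<open>W / sqrt K\<close>.

By random restrictions the bound on \<open>q'''\<close> reduces to a lower bound for the third Fourier level
of two increasing functions, and by a random splitting of the coordinates to the following
one for two probability densities \<open>h\<close>, \<open>k\<close>: if \<open>x\<close> and \<open>y\<close> are independent with these laws, then
\<open>E \<langle>x, y\<rangle>\<^sup>2 - n \<ge> - 4 (Ent h + Ent k)\<close>. For this one writes \<open>x = m + \<epsilon>\<close> with \<open>m\<^sub>j\<close> the conditional mean of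
\<open>x\<^sub>j\<close> given the coordinates revealed before it; then \<open>E |m|\<^sup>2 \<le> 2 Ent h\<close> by the chain rule, and the
martingale differences \<open>\<epsilon>\<^sub>j\<close> are orthogonal.
\<close>

section \<open>Expectations and Fourier coefficients on the cube\<close>

text \<open>A point of the cube is encoded by the set \<open>X \<subseteq> V\<close> of the coordinates at which it equals \<open>1\<close>.
  Under \<open>bexp p V\<close> each element of \<open>V\<close> belongs to \<open>X\<close> independently with probability \<open>p\<close>.\<close>

definition sg :: "'a \<Rightarrow> 'a set \<Rightarrow> real" where
  "sg i X = (if i \<in> X then 1 else -1)"

definition bexp :: "real \<Rightarrow> 'a set \<Rightarrow> ('a set \<Rightarrow> real) \<Rightarrow> real" where
  "bexp p V F = (\<Sum>X\<in>Pow V. p ^ card X * (1 - p) ^ card (V - X) * F X)"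

abbreviation uexp :: "'a set \<Rightarrow> ('a set \<Rightarrow> real) \<Rightarrow> real" where
  "uexp \<equiv> bexp (1/2)"

definition chi :: "'a set \<Rightarrow> 'a set \<Rightarrow> real" where
  "chi S X = (\<Prod>i\<in>S. sg i X)"

definition fcoeff :: "'a set \<Rightarrow> ('a set \<Rightarrow> real) \<Rightarrow> 'a set \<Rightarrow> real" where
  "fcoeff V f S = uexp V (\<lambda>X. f X * chi S X)"

lemma sg_sq [simp]: "sg i X * sg i X = 1"
  by (simp add: sg_def)

lemma bexp_empty [simp]: "bexp p {} F = F {}"
  by (simp add: bexp_def)

text \<open>Conditioning on whether \<open>a\<close> belongs to the random set; this recursion
  drives the inductions on the coordinates.\<close>

lemma bexp_insert:
  assumes "finite V" "a \<notin> V"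
  shows "bexp p (insert a V) F = p * bexp p V (\<lambda>X. F (insert a X)) + (1 - p) * bexp p V F"
proof -
  have inj: "inj_on (insert a) (Pow V)"
    using assms by (auto simp: inj_on_def)
  have disj: "Pow V \<inter> insert a ` Pow V = {}"
    using assms by auto
  have 1: "p ^ card (insert a X) * (1 - p) ^ card (insert a V - insert a X) * F (insert a X)
      = p * (p ^ card X * (1 - p) ^ card (V - X) * F (insert a X))" if "X \<in> Pow V" for X
  proof -
    have "insert a V - insert a X = V - X" using assms that by auto
    moreover have "card (insert a X) = Suc (card X)"
      using assms that by (subst card_insert_disjoint) (auto intro: finite_subset)
    ultimately show ?thesis by simp
  qed
  have 2: "p ^ card X * (1 - p) ^ card (insert a V - X) * F X
      = (1 - p) * (p ^ card X * (1 - p) ^ card (V - X) * F X)" if "X \<in> Pow V" for X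
  proof -
    have "insert a V - X = insert a (V - X)" using assms that by auto
    then show ?thesis using assms by simp
  qed
  have "bexp p (insert a V) F
      = (\<Sum>X\<in>Pow V. p ^ card X * (1 - p) ^ card (insert a V - X) * F X)
      + (\<Sum>X\<in>insert a ` Pow V. p ^ card X * (1 - p) ^ card (insert a V - X) * F X)"
    unfolding bexp_def Pow_insert using assms disj by (intro sum.union_disjoint) auto
  also have "(\<Sum>X\<in>insert a ` Pow V. p ^ card X * (1 - p) ^ card (insert a V - X) * F X)
      = p * bexp p V (\<lambda>X. F (insert a X))"
    unfolding sum.reindex[OF inj] bexp_def sum_distrib_left o_def by (intro sum.cong refl 1)
  also have "(\<Sum>X\<in>Pow V. p ^ card X * (1 - p) ^ card (insert a V - X) * F X) = (1 - p) * bexp p V F"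
    unfolding bexp_def sum_distrib_left by (intro sum.cong refl 2)
  finally show ?thesis by simp
qed

lemma bexp_cong: "(\<And>X. X \<subseteq> V \<Longrightarrow> F X = G X) \<Longrightarrow> bexp p V F = bexp p V G"
  unfolding bexp_def by (intro sum.cong) auto

lemma bexp_add: "bexp p V (\<lambda>X. F X + G X) = bexp p V F + bexp p V G"
  by (simp add: bexp_def sum.distrib algebra_simps)

lemma bexp_diff: "bexp p V (\<lambda>X. F X - G X) = bexp p V F - bexp p V G"
  by (simp add: bexp_def sum_subtractf algebra_simps)

lemma bexp_cmult: "bexp p V (\<lambda>X. c * F X) = c * bexp p V F"
  by (simp add: bexp_def sum_distrib_left mult.left_commute)

lemma bexp_multc: "bexp p V (\<lambda>X. F X * c) = bexp p V F * c"
  by (simp add: bexp_def sum_distrib_right mult.assoc)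

lemma bexp_uminus: "bexp p V (\<lambda>X. - F X) = - bexp p V F"
  by (simp add: bexp_def sum_negf)

lemma bexp_sum: "bexp p V (\<lambda>X. \<Sum>i\<in>A. F i X) = (\<Sum>i\<in>A. bexp p V (F i))"
  unfolding bexp_def sum_distrib_left by (rule sum.swap)

lemma bexp_zero [simp]: "bexp p V (\<lambda>X. 0) = 0"
  by (simp add: bexp_def)

lemma bexp_const [simp]: "finite V \<Longrightarrow> bexp p V (\<lambda>X. c) = c"
  by (induction V rule: finite_induct) (simp_all add: bexp_insert algebra_simps)

lemma bexp_one [simp]: "finite V \<Longrightarrow> bexp 1 V F = F V"
  by (induction V arbitrary: F rule: finite_induct) (simp_all add: bexp_insert)

lemma bexp_mono:
  assumes "0 \<le> p" "p \<le> 1" "\<And>X. X \<subseteq> V \<Longrightarrow> F X \<le> G X"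
  shows "bexp p V F \<le> bexp p V G"
  unfolding bexp_def using assms by (intro sum_mono mult_left_mono) auto

lemma bexp_nonneg:
  assumes "0 \<le> p" "p \<le> 1" "\<And>X. X \<subseteq> V \<Longrightarrow> 0 \<le> F X"
  shows "0 \<le> bexp p V F"
  using bexp_mono[of p V "\<lambda>X. 0" F] assms by simp

lemma uexp_eq_zeroD:
  assumes "finite V" "\<And>X. X \<subseteq> V \<Longrightarrow> 0 \<le> F X" "uexp V F = 0" "X \<subseteq> V"
  shows "F X = 0"
proof -
  have "(1/2) ^ card X * (1 - 1/2) ^ card (V - X) * F X = (0::real)"
    using assms unfolding bexp_def
    by (subst (asm) sum_nonneg_eq_0_iff) auto
  then show ?thesis by simp
qed

lemma bexp_Un:
  assumes "finite A" "finite B" "A \<inter> B = {}"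
  shows "bexp p (A \<union> B) F = bexp p A (\<lambda>X. bexp p B (\<lambda>Y. F (X \<union> Y)))"
  using assms
proof (induction A arbitrary: F rule: finite_induct)
  case (insert a A)
  then show ?case by (simp add: bexp_insert)
qed simp

lemma uexp_compl:
  assumes "finite V"
  shows "uexp V (\<lambda>X. F (V - X)) = uexp V F"
  unfolding bexp_def
proof (rule sum.reindex_bij_witness[of _ "\<lambda>X. V - X" "\<lambda>X. V - X"])
  fix X assume "X \<in> Pow V"
  then show "(1/2::real) ^ card (V - X) * (1 - 1/2) ^ card (V - (V - X)) * F (V - X)
      = (1/2) ^ card X * (1 - 1/2) ^ card (V - X) * F (V - X)"
    by (simp add: double_diff algebra_simps)
qed auto

section \<open>Adding a coordinate to characters and Fourier coefficients\<close>

lemma chi_insert_new: "finite S \<Longrightarrow> a \<notin> S \<Longrightarrow> chi (insert a S) X = sg a X * chi S X"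
  by (simp add: chi_def)

lemma chi_insert_point: "a \<notin> S \<Longrightarrow> chi S (insert a X) = chi S X"
  unfolding chi_def sg_def by (intro prod.cong) auto

lemma fcoeff_insert_notin:
  assumes "finite V" "a \<notin> V" "a \<notin> S"
  shows "fcoeff (insert a V) f S = (fcoeff V (\<lambda>X. f (insert a X)) S + fcoeff V f S) / 2"
  using assms by (simp add: fcoeff_def bexp_insert chi_insert_point)

lemma fcoeff_insert_in:
  assumes "finite V" "a \<notin> V" "finite S" "a \<notin> S"
  shows "fcoeff (insert a V) f (insert a S) = (fcoeff V (\<lambda>X. f (insert a X)) S - fcoeff V f S) / 2"
proof -
  have "bexp (1/2) V (\<lambda>X. f X * chi (insert a S) X) = bexp (1/2) V (\<lambda>X. - (f X * chi S X))"
    using assms by (intro bexp_cong) (auto simp: chi_insert_new sg_def)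
  moreover have "chi (insert a S) (insert a X) = chi S X" for X
    using assms by (simp add: chi_insert_new chi_insert_point sg_def)
  ultimately show ?thesis
    using assms by (simp add: fcoeff_def bexp_insert bexp_uminus)
qed

lemma fcoeff_empty_set [simp]: "fcoeff V f {} = uexp V f"
  by (simp add: fcoeff_def chi_def)

lemma fcoeff_cong: "(\<And>X. X \<subseteq> V \<Longrightarrow> f X = g X) \<Longrightarrow> fcoeff V f S = fcoeff V g S"
  unfolding fcoeff_def by (intro bexp_cong) auto

section \<open>Entropy and the second Fourier level\<close>

text \<open>Pinsker's inequality for one bit of bias \<open>t\<close>. Both sides agree to second
  order at 0, so the constant is sharp, and two differentiations reduce the claim to
  \<open>1 / (1 + y) + 1 / (1 - y) >= 2\<close>.\<close>

lemma two_point_entropy_sym: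
  fixes t :: real
  assumes "0 \<le> t" "t \<le> 1"
  shows "t\<^sup>2 \<le> (1 + t) * ln (1 + t) + (1 - t) * ln (1 - t)"
proof (cases "t = 1")
  case True
  have "1 - 1/2 \<le> ln (2::real)"
    using ln_le_minus_one[of "1/2::real"] by (simp add: ln_div)
  then show ?thesis using True by simp
next
  case False
  then have t1: "t < 1" using assms by simp
  let ?F = "\<lambda>t::real. (1 + t) * ln (1 + t) + (1 - t) * ln (1 - t) - t\<^sup>2"
  have "?F 0 \<le> ?F t"
  proof (rule DERIV_nonneg_imp_nondecreasing[of 0 t ?F])
    fix x assume x: "0 \<le> x" "x \<le> t"
    then have x1: "x < 1" using t1 by simp
    have "(?F has_real_derivative ln (1 + x) - ln (1 - x) - 2 * x) (at x)"
      using x x1 by (auto intro!: derivative_eq_intros)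
    moreover have "0 \<le> ln (1 + x) - ln (1 - x) - 2 * x"
    proof -
      let ?G = "\<lambda>x::real. ln (1 + x) - ln (1 - x) - 2 * x"
      have "?G 0 \<le> ?G x"
      proof (rule DERIV_nonneg_imp_nondecreasing[of 0 x ?G])
        fix y assume y: "0 \<le> y" "y \<le> x"
        then have y1: "y < 1" using x1 by simp
        have "(?G has_real_derivative 1 / (1 + y) + 1 / (1 - y) - 2) (at y)"
          using y y1 by (auto intro!: derivative_eq_intros)
        moreover have "1 - y \<le> 1 / (1 + y)" "1 + y \<le> 1 / (1 - y)"
          using y y1 by (subst pos_le_divide_eq; simp add: algebra_simps)+
        then have "0 \<le> 1 / (1 + y) + 1 / (1 - y) - 2" by linarith
        ultimately show "\<exists>d. (?G has_real_derivative d) (at y) \<and> 0 \<le> d" by blast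
      qed (use x in auto)
      then show ?thesis by simp
    qed
    ultimately show "\<exists>d. (?F has_real_derivative d) (at x) \<and> 0 \<le> d" by blast
  qed (use assms in auto)
  then show ?thesis by simp
qed

text \<open>With the bias \<open>t\<close>, \<open>a = c * (1 + t)\<close> and
  \<open>b = c * (1 - t)\<close>, so the terms in \<open>ln c\<close> cancel. Later \<open>a\<close>
  and \<open>b\<close> are the means of a density on two halves of the cube, which makes this one
  step of the entropy chain rule.\<close>

lemma two_point_entropy:
  fixes a b :: real
  assumes "0 \<le> a" "0 \<le> b"
  defines "c \<equiv> (a + b) / 2"
  shows "c * ((a - b) / (a + b))\<^sup>2 \<le> 2 * ((a * ln a + b * ln b) / 2 - c * ln c)"
proof (cases "a + b = 0")
  case True
  then have "a = 0" "b = 0" using assms by auto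
  then show ?thesis by (simp add: c_def)
next
  case False
  then have c: "c > 0" using assms by simp
  define t where "t = (a - b) / (a + b)"
  have a: "a = c * (1 + t)" and b: "b = c * (1 - t)"
    using False by (auto simp: t_def c_def field_simps)
  have t: "\<bar>t\<bar> \<le> 1" using assms False by (auto simp: t_def abs_if field_simps)
  have ent: "t\<^sup>2 \<le> (1 + t) * ln (1 + t) + (1 - t) * ln (1 - t)"
    using two_point_entropy_sym[of "\<bar>t\<bar>"] t by (cases "t \<ge> 0") (auto simp: algebra_simps)
  have xlnx: "x * ln (c * x) = x * ln c + x * ln x" if "x \<ge> 0" for x
    using c that by (cases "x = 0") (auto simp: ln_mult algebra_simps)
  have two_eq: "2 * (S / 2 - C) = Z" if "S = Z + 2 * C" for S C Z :: real
    using that by (simp add: field_simps)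
  have "a * ln a + b * ln b = c * ((1 + t) * ln (c * (1 + t)) + (1 - t) * ln (c * (1 - t)))"
    by (simp add: a b algebra_simps)
  also have "\<dots> = c * ((1 + t) * ln (1 + t) + (1 - t) * ln (1 - t)) + 2 * (c * ln c)"
  proof -
    have "(1 + t) * ln (c * (1 + t)) = (1 + t) * ln c + (1 + t) * ln (1 + t)"
      "(1 - t) * ln (c * (1 - t)) = (1 - t) * ln c + (1 - t) * ln (1 - t)"
      by (rule xlnx; use t in linarith)+
    then show ?thesis by (simp add: distrib_left) (simp add: algebra_simps)
  qed
  finally have "2 * ((a * ln a + b * ln b) / 2 - c * ln c)
      = c * ((1 + t) * ln (1 + t) + (1 - t) * ln (1 - t))" by (rule two_eq)
  moreover have "c * t\<^sup>2 \<le> c * ((1 + t) * ln (1 + t) + (1 - t) * ln (1 - t))"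
    using ent c by (intro mult_left_mono) auto
  ultimately show ?thesis by (simp add: t_def)
qed

text \<open>The function \<open>m j\<close> plays the role of the conditional mean of the \<open>j\<close>-th coordinate given its
  predecessors, under the density \<open>h\<close>. Building \<open>m\<close> by induction on \<open>J\<close> avoids fixing an order on the
  coordinates; the last clause is the chain rule for entropy. The convention \<open>ln 0 = 0\<close> is harmless,
  as the logarithms occur only in the form \<open>x * ln x\<close>.\<close>

definition mart_decomp :: "'a set \<Rightarrow> ('a set \<Rightarrow> real) \<Rightarrow> ('a \<Rightarrow> 'a set \<Rightarrow> real) \<Rightarrow> bool" where
  "mart_decomp J h m \<longleftrightarrow>
     (\<forall>j\<in>J. uexp J (\<lambda>X. h X * (sg j X - m j X)) = 0) \<and>
     (\<forall>j\<in>J. \<forall>l\<in>J. j \<noteq> l \<longrightarrow> uexp J (\<lambda>X. h X * ((sg j X - m j X) * (sg l X - m l X))) = 0) \<and>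
     (\<forall>j\<in>J. uexp J (\<lambda>X. h X * (m j X * (sg j X - m j X))) = 0) \<and>
     (\<Sum>j\<in>J. uexp J (\<lambda>X. h X * (m j X)\<^sup>2))
       \<le> 2 * (uexp J (\<lambda>X. h X * ln (h X)) - uexp J h * ln (uexp J h))"

text \<open>The coordinate \<open>a\<close> is revealed first, so its conditional mean is a constant
  \<open>t\<close>; on each of the two halves the induction hypothesis supplies the other means.
  Centering on the halves gives orthogonality, and the two-point inequality for the means
  \<open>A\<close>, \<open>B\<close> pays for the new term in the entropy bound.\<close>

lemma ex_mart_decomp:
  assumes "finite J" "\<And>X. X \<subseteq> J \<Longrightarrow> 0 \<le> h X"
  shows "\<exists>m. mart_decomp J h m"
  using assms
proof (induction J arbitrary: h rule: finite_induct)
  case (insert a J)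
  let ?p = "\<lambda>X. h (insert a X)"
  have "\<exists>m. mart_decomp J ?p m" "\<exists>m. mart_decomp J h m"
    by (rule insert.IH; rule insert.prems; blast)+
  then obtain mp mn where dp: "mart_decomp J ?p mp" and mn: "mart_decomp J h mn" by blast
  note p1 = dp[unfolded mart_decomp_def, THEN conjunct1, THEN bspec]
    and p2 = dp[unfolded mart_decomp_def, THEN conjunct2, THEN conjunct1, THEN bspec, THEN bspec, THEN HOL.mp]
    and p3 = dp[unfolded mart_decomp_def, THEN conjunct2, THEN conjunct2, THEN conjunct1, THEN bspec]
    and p4 = dp[unfolded mart_decomp_def, THEN conjunct2, THEN conjunct2, THEN conjunct2]
  note n1 = mn[unfolded mart_decomp_def, THEN conjunct1, THEN bspec]
    and n2 = mn[unfolded mart_decomp_def, THEN conjunct2, THEN conjunct1, THEN bspec, THEN bspec, THEN HOL.mp]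
    and n3 = mn[unfolded mart_decomp_def, THEN conjunct2, THEN conjunct2, THEN conjunct1, THEN bspec]
    and n4 = mn[unfolded mart_decomp_def, THEN conjunct2, THEN conjunct2, THEN conjunct2]
  define A where "A = uexp J ?p"
  define B where "B = uexp J h"
  have AB: "A \<ge> 0" "B \<ge> 0" unfolding A_def B_def
    by (intro bexp_nonneg insert.prems; auto)+
  \<comment> \<open>If \<open>A + B = 0\<close> then \<open>A = B = 0\<close> and division yields
    \<open>t = 0\<close>; the identities for \<open>t\<close> below hold in that case too.\<close>
  define t where "t = (A - B) / (A + B)"
  define m where "m j X = (if j = a then t else if a \<in> X then mp j (X - {a}) else mn j X)" for j X
  have split: "uexp (insert a J) F = (uexp J (\<lambda>X. F (insert a X)) + uexp J F) / 2" for F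
    using insert.hyps by (simp add: bexp_insert)
  have mJ: "m j (insert a X) = mp j X" "m j X = mn j X" "sg j (insert a X) = sg j X"
    if "j \<in> J" "X \<subseteq> J" for j X
  proof -
    have "j \<noteq> a" "a \<notin> X" using that insert.hyps by auto
    then show "m j (insert a X) = mp j X" "m j X = mn j X" "sg j (insert a X) = sg j X"
      by (auto simp: m_def sg_def)
  qed
  have ma: "m a X = t" for X by (simp add: m_def)
  have sa: "sg a (insert a X) = 1" "X \<subseteq> J \<Longrightarrow> sg a X = -1" for X
    using insert.hyps by (auto simp: sg_def)
  have sp: "uexp J (\<lambda>X. \<Phi> (h (insert a X)) (m j (insert a X)) (sg j (insert a X)))
      = uexp J (\<lambda>X. \<Phi> (?p X) (mp j X) (sg j X))"
    "uexp J (\<lambda>X. \<Phi> (h X) (m j X) (sg j X)) = uexp J (\<lambda>X. \<Phi> (h X) (mn j X) (sg j X))"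
    if "j \<in> J" for j \<Phi>
    using that mJ by (auto intro!: bexp_cong)
  have tAB: "t * (A + B) = A - B" "A * (1 - t) = B * (1 + t)"
    using AB by (cases "A + B = 0"; auto simp: t_def field_simps)+
  have ea: "uexp (insert a J) (\<lambda>X. h X * (sg a X - m a X)) = 0"
  proof -
    have "uexp (insert a J) (\<lambda>X. h X * (sg a X - m a X))
        = (uexp J (\<lambda>X. ?p X * (1 - t)) + uexp J (\<lambda>X. h X * (- 1 - t))) / 2"
      unfolding split by (intro arg_cong2[where f = "\<lambda>x y. (x + y) / 2"] bexp_cong) (auto simp: ma sa)
    also have "\<dots> = (A * (1 - t) + B * (- 1 - t)) / 2"
      by (simp add: bexp_multc A_def B_def del: mult_minus_left mult_minus_right)
    also have "\<dots> = 0" using tAB by (simp add: algebra_simps)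
    finally show ?thesis .
  qed
  have eaj: "uexp (insert a J) (\<lambda>X. h X * ((sg a X - m a X) * (sg j X - m j X))) = 0" if j: "j \<in> J" for j
  proof -
    have "uexp (insert a J) (\<lambda>X. h X * ((sg a X - m a X) * (sg j X - m j X)))
        = (uexp J (\<lambda>X. (1 - t) * (?p X * (sg j X - mp j X))) + uexp J (\<lambda>X. (- 1 - t) * (h X * (sg j X - mn j X)))) / 2"
      unfolding split by (intro arg_cong2[where f = "\<lambda>x y. (x + y) / 2"] bexp_cong) (auto simp: ma sa mJ j)
    also have "\<dots> = 0"
      unfolding bexp_cmult using p1 n1 j by simp
    finally show ?thesis .
  qed
  have "\<forall>j\<in>insert a J. uexp (insert a J) (\<lambda>X. h X * (sg j X - m j X)) = 0"
    using ea p1 n1 by (auto simp: split sp[of _ "\<lambda>h m s. h * (s - m)"])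
  moreover have "uexp (insert a J) (\<lambda>X. h X * ((sg j X - m j X) * (sg l X - m l X))) = 0"
    if jl: "j \<in> insert a J" "l \<in> insert a J" "j \<noteq> l" for j l
  proof -
    consider "j = a" "l \<in> J" | "l = a" "j \<in> J" | "j \<in> J" "l \<in> J" using jl by auto
    then show ?thesis
    proof cases
      case 1 then show ?thesis using eaj by simp
    next
      case 2 then show ?thesis using eaj[of j] by (simp add: mult.commute[of "sg a _ - _"])
    next
      case 3
      have "uexp J (\<lambda>X. h (insert a X) * ((sg j (insert a X) - m j (insert a X)) * (sg l (insert a X) - m l (insert a X))))
         = uexp J (\<lambda>X. ?p X * ((sg j X - mp j X) * (sg l X - mp l X)))"
        "uexp J (\<lambda>X. h X * ((sg j X - m j X) * (sg l X - m l X)))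
         = uexp J (\<lambda>X. h X * ((sg j X - mn j X) * (sg l X - mn l X)))"
        using 3 mJ by (auto intro!: bexp_cong)
      then show ?thesis using p2 n2 3 jl by (simp add: split)
    qed
  qed
  moreover have "uexp (insert a J) (\<lambda>X. h X * (m j X * (sg j X - m j X))) = 0" if "j \<in> insert a J" for j
  proof (cases "j = a")
    case True
    have "uexp (insert a J) (\<lambda>X. h X * (m a X * (sg a X - m a X))) = uexp (insert a J) (\<lambda>X. t * (h X * (sg a X - m a X)))"
      by (simp add: ma algebra_simps)
    also have "\<dots> = 0" unfolding bexp_cmult ea by simp
    finally show ?thesis using True by simp
  next
    case False
    then show ?thesis using that p3 n3
      by (auto simp: split sp[of _ "\<lambda>h m s. h * (m * (s - m))"])
  qed
  moreover have "(\<Sum>j\<in>insert a J. uexp (insert a J) (\<lambda>X. h X * (m j X)\<^sup>2))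
       \<le> 2 * (uexp (insert a J) (\<lambda>X. h X * ln (h X)) - uexp (insert a J) h * ln (uexp (insert a J) h))"
  proof -
    have s1: "(\<Sum>j\<in>J. uexp (insert a J) (\<lambda>X. h X * (m j X)\<^sup>2))
      = ((\<Sum>j\<in>J. uexp J (\<lambda>X. ?p X * (mp j X)\<^sup>2)) + (\<Sum>j\<in>J. uexp J (\<lambda>X. h X * (mn j X)\<^sup>2))) / 2"
      by (simp add: split sp[of _ "\<lambda>h m s. h * m\<^sup>2"] sum.distrib flip: sum_divide_distrib)
    have s2: "uexp (insert a J) (\<lambda>X. h X * (m a X)\<^sup>2) = (A + B) / 2 * t\<^sup>2"
      unfolding ma bexp_multc split A_def B_def ..
    have s3: "(A + B) / 2 * t\<^sup>2 \<le> 2 * ((A * ln A + B * ln B) / 2 - (A + B) / 2 * ln ((A + B) / 2))"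
      unfolding t_def using two_point_entropy[OF AB] by simp
    have s4: "uexp (insert a J) h = (A + B) / 2" by (simp add: split A_def B_def)
    have s5: "uexp (insert a J) (\<lambda>X. h X * ln (h X))
        = (uexp J (\<lambda>X. ?p X * ln (?p X)) + uexp J (\<lambda>X. h X * ln (h X))) / 2" by (simp add: split)
    show ?thesis
      unfolding sum.insert[OF insert.hyps] s1 s2 s4 s5
      using p4 n4 s3 unfolding A_def[symmetric] B_def[symmetric] by argo
  qed
  ultimately show ?case unfolding mart_decomp_def by (intro exI[of _ m] conjI ballI impI) auto
next
  case empty
  then show ?case by (auto simp: mart_decomp_def)
qed

text \<open>Expansion of the weighted square norm of \<open>\<phi>\<close> minus
  \<open>\<Sum>l\<in>L. c l * e l\<close>. The norms may be smaller than 1, as they are for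
  martingale differences.\<close>

lemma bessel:
  fixes h \<phi> :: "'a set \<Rightarrow> real" and e :: "'b \<Rightarrow> 'a set \<Rightarrow> real"
  assumes "finite L" "\<And>X. X \<subseteq> J \<Longrightarrow> 0 \<le> h X"
    and orth: "\<And>l l'. l \<in> L \<Longrightarrow> l' \<in> L \<Longrightarrow> l \<noteq> l' \<Longrightarrow> uexp J (\<lambda>X. h X * (e l X * e l' X)) = 0"
    and norm: "\<And>l. l \<in> L \<Longrightarrow> uexp J (\<lambda>X. h X * (e l X * e l X)) \<le> 1"
  shows "(\<Sum>l\<in>L. (uexp J (\<lambda>X. h X * (\<phi> X * e l X)))\<^sup>2) \<le> uexp J (\<lambda>X. h X * (\<phi> X)\<^sup>2)"
proof -
  define c where "c l = uexp J (\<lambda>X. h X * (\<phi> X * e l X))" for l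
  have "0 \<le> uexp J (\<lambda>X. h X * (\<phi> X - (\<Sum>l\<in>L. c l * e l X))\<^sup>2)"
    using assms by (intro bexp_nonneg) auto
  also have "(\<lambda>X. h X * (\<phi> X - (\<Sum>l\<in>L. c l * e l X))\<^sup>2)
      = (\<lambda>X. h X * (\<phi> X)\<^sup>2 - 2 * (\<Sum>l\<in>L. c l * (h X * (\<phi> X * e l X)))
          + (\<Sum>l\<in>L. \<Sum>l'\<in>L. c l * c l' * (h X * (e l X * e l' X))))"
  proof
    fix X
    have "h X * (\<phi> X - (\<Sum>l\<in>L. c l * e l X))\<^sup>2 = h X * (\<phi> X)\<^sup>2 - 2 * (h X * \<phi> X * (\<Sum>l\<in>L. c l * e l X))
        + h X * ((\<Sum>l\<in>L. c l * e l X) * (\<Sum>l\<in>L. c l * e l X))"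
      by (simp add: power2_eq_square algebra_simps)
    also have "h X * \<phi> X * (\<Sum>l\<in>L. c l * e l X) = (\<Sum>l\<in>L. c l * (h X * (\<phi> X * e l X)))"
      by (simp add: sum_distrib_left mult_ac)
    also have "h X * ((\<Sum>l\<in>L. c l * e l X) * (\<Sum>l\<in>L. c l * e l X))
        = (\<Sum>l\<in>L. \<Sum>l'\<in>L. c l * c l' * (h X * (e l X * e l' X)))"
      by (simp add: sum_product sum_distrib_left mult_ac)
    finally show "h X * (\<phi> X - (\<Sum>l\<in>L. c l * e l X))\<^sup>2
      = h X * (\<phi> X)\<^sup>2 - 2 * (\<Sum>l\<in>L. c l * (h X * (\<phi> X * e l X)))
          + (\<Sum>l\<in>L. \<Sum>l'\<in>L. c l * c l' * (h X * (e l X * e l' X)))" .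
  qed
  also have "uexp J \<dots> = uexp J (\<lambda>X. h X * (\<phi> X)\<^sup>2) - 2 * (\<Sum>l\<in>L. c l * c l)
      + (\<Sum>l\<in>L. \<Sum>l'\<in>L. c l * c l' * uexp J (\<lambda>X. h X * (e l X * e l' X)))"
    by (simp add: bexp_add bexp_diff bexp_cmult bexp_sum c_def)
  also have "(\<Sum>l\<in>L. \<Sum>l'\<in>L. c l * c l' * uexp J (\<lambda>X. h X * (e l X * e l' X)))
      = (\<Sum>l\<in>L. c l * c l * uexp J (\<lambda>X. h X * (e l X * e l X)))"
  proof (intro sum.cong refl)
    fix l assume l: "l \<in> L"
    have "(\<Sum>l'\<in>L. c l * c l' * uexp J (\<lambda>X. h X * (e l X * e l' X)))
        = (\<Sum>l'\<in>{l}. c l * c l' * uexp J (\<lambda>X. h X * (e l X * e l' X)))"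
      using assms(1) l orth by (intro sum.mono_neutral_right) auto
    then show "(\<Sum>l'\<in>L. c l * c l' * uexp J (\<lambda>X. h X * (e l X * e l' X)))
        = c l * c l * uexp J (\<lambda>X. h X * (e l X * e l X))" by simp
  qed
  also have "\<dots> \<le> (\<Sum>l\<in>L. c l * c l * 1)"
    using norm by (intro sum_mono mult_left_mono) auto
  finally show ?thesis by (simp add: c_def power2_eq_square)
qed

lemma uexp_bilinear:
  "uexp J (\<lambda>X. uexp J (\<lambda>Y. h X * k Y * ((\<Sum>j\<in>A. a j X * a' j Y) * (\<Sum>l\<in>B. b l X * b' l Y))))
   = (\<Sum>j\<in>A. \<Sum>l\<in>B. uexp J (\<lambda>X. h X * (a j X * b l X)) * uexp J (\<lambda>Y. k Y * (a' j Y * b' l Y)))"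
proof -
  have "h X * k Y * ((\<Sum>j\<in>A. a j X * a' j Y) * (\<Sum>l\<in>B. b l X * b' l Y))
      = (\<Sum>j\<in>A. \<Sum>l\<in>B. (h X * (a j X * b l X)) * (k Y * (a' j Y * b' l Y)))" for X Y
    unfolding sum_product unfolding sum_distrib_left by (intro sum.cong refl) (simp add: mult_ac)
  then show ?thesis by (simp only: bexp_sum bexp_cmult bexp_multc)
qed

lemma sum_split_diagonal:
  fixes F :: "'a \<Rightarrow> 'a \<Rightarrow> 'b::comm_monoid_add"
  assumes "finite J"
  shows "(\<Sum>j\<in>J. \<Sum>l\<in>J. F j l) = (\<Sum>j\<in>J. F j j) + (\<Sum>j\<in>J. \<Sum>l\<in>J - {j}. F j l)"
  using assms by (simp add: sum.remove[of J _ "F _"] flip: sum.distrib)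

text \<open>For independent \<open>x\<close>, \<open>y\<close> with densities \<open>h\<close>,
  \<open>k\<close>, let \<open>L\<close> be the inner product of \<open>x\<close> and
  \<open>y\<close>, and \<open>S\<close> that of their martingale differences. Then
  \<open>E L^2 >= 2 * E (L * S) - E S^2 = \<Delta> + 2 * U\<close>. The loss in
  \<open>\<Delta>\<close> and the cross term \<open>2 * U\<close> each cost at most the total energy
  of \<open>m\<close> and \<open>m'\<close>, by Bessel in the case of \<open>U\<close>, and entropy
  controls that energy.\<close>

lemma level2_pairing_lower:
  assumes J: "finite J" and h: "\<And>X. X \<subseteq> J \<Longrightarrow> 0 \<le> h X" and k: "\<And>X. X \<subseteq> J \<Longrightarrow> 0 \<le> k X"
    and h1: "uexp J h = 1" and k1: "uexp J k = 1"
  shows "- 4 * (uexp J (\<lambda>X. h X * ln (h X)) + uexp J (\<lambda>X. k X * ln (k X)))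
    \<le> (\<Sum>j\<in>J. \<Sum>l\<in>J - {j}. uexp J (\<lambda>X. h X * (sg j X * sg l X)) * uexp J (\<lambda>X. k X * (sg j X * sg l X)))"
proof -
  obtain m m' where md: "mart_decomp J h m" and md': "mart_decomp J k m'"
    using ex_mart_decomp[OF J, of h] ex_mart_decomp[OF J, of k] h k by blast
  define e where "e j X = sg j X - m j X" for j X
  define e' where "e' j X = sg j X - m' j X" for j X
  define d where "d j = uexp J (\<lambda>X. h X * (m j X)\<^sup>2)" for j
  define d' where "d' j = uexp J (\<lambda>X. k X * (m' j X)\<^sup>2)" for j
  define u where "u j l = uexp J (\<lambda>X. h X * (m j X * e l X))" for j l
  define u' where "u' j l = uexp J (\<lambda>X. k X * (m' j X * e' l X))" for j l
  have H: "(\<forall>j\<in>J. u j j = 0) \<and> (\<forall>j\<in>J. \<forall>l\<in>J. j \<noteq> l \<longrightarrow> uexp J (\<lambda>X. h X * (e j X * e l X)) = 0)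
     \<and> (\<Sum>j\<in>J. d j) \<le> 2 * uexp J (\<lambda>X. h X * ln (h X))"
    using md h1 by (simp add: mart_decomp_def u_def d_def e_def)
  have K: "(\<forall>j\<in>J. u' j j = 0) \<and> (\<forall>j\<in>J. \<forall>l\<in>J. j \<noteq> l \<longrightarrow> uexp J (\<lambda>X. k X * (e' j X * e' l X)) = 0)
     \<and> (\<Sum>j\<in>J. d' j) \<le> 2 * uexp J (\<lambda>X. k X * ln (k X))"
    using md' k1 by (simp add: mart_decomp_def u'_def d'_def e'_def)
  have HO: "uexp J (\<lambda>X. h X * (e j X * e l X)) = 0"
    and KO: "uexp J (\<lambda>X. k X * (e' j X * e' l X)) = 0" if "j \<in> J" "l \<in> J \<and> l \<noteq> j" for j l
    using H K that by auto
  have d0: "0 \<le> d j" "0 \<le> d' j" for j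
    unfolding d_def d'_def by (intro bexp_nonneg mult_nonneg_nonneg h k zero_le_power2; simp)+
  \<comment> \<open>Substitutes \<open>sg j = m j + e j\<close>; for indices in \<open>J\<close>,
    the first term vanishes if \<open>j = l\<close> and the second if
    \<open>j \<noteq> l\<close>.\<close>
  have se: "uexp J (\<lambda>X. h X * (sg j X * e l X)) = u j l + uexp J (\<lambda>X. h X * (e j X * e l X))" for j l
    unfolding u_def bexp_add[symmetric] by (simp add: e_def algebra_simps)
  have se': "uexp J (\<lambda>X. k X * (sg j X * e' l X)) = u' j l + uexp J (\<lambda>X. k X * (e' j X * e' l X))" for j l
    unfolding u'_def bexp_add[symmetric] by (simp add: e'_def algebra_simps)
  have ee: "uexp J (\<lambda>X. h X * (e j X * e j X)) = 1 - d j" if "j \<in> J" for j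
  proof -
    have "(\<lambda>X. h X * (e j X * e j X)) = (\<lambda>X. h X - 2 * (h X * (m j X * e j X)) - h X * (m j X)\<^sup>2)"
      by (rule ext) (simp add: e_def algebra_simps power2_eq_square)
    then show ?thesis using H that h1 by (simp add: bexp_diff bexp_cmult d_def u_def)
  qed
  have ee': "uexp J (\<lambda>X. k X * (e' j X * e' j X)) = 1 - d' j" if "j \<in> J" for j
  proof -
    have "(\<lambda>X. k X * (e' j X * e' j X)) = (\<lambda>X. k X - 2 * (k X * (m' j X * e' j X)) - k X * (m' j X)\<^sup>2)"
      by (rule ext) (simp add: e'_def algebra_simps power2_eq_square)
    then show ?thesis using K that k1 by (simp add: bexp_diff bexp_cmult d'_def u'_def)
  qed
  define \<Delta> where "\<Delta> = (\<Sum>j\<in>J. (1 - d j) * (1 - d' j))"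
  define U where "U = (\<Sum>j\<in>J. \<Sum>l\<in>J - {j}. u j l * u' j l)"
  define Q where "Q = (\<Sum>j\<in>J. \<Sum>l\<in>J - {j}. uexp J (\<lambda>X. h X * (sg j X * sg l X)) * uexp J (\<lambda>X. k X * (sg j X * sg l X)))"
  let ?D = "\<lambda>\<Phi>. uexp J (\<lambda>X. uexp J (\<lambda>Y. h X * k Y * \<Phi> X Y))"
  let ?L = "\<lambda>X Y. \<Sum>j\<in>J. sg j X * sg j Y"
  let ?S = "\<lambda>X Y. \<Sum>j\<in>J. e j X * e' j Y"
  \<comment> \<open>The bound comes from the positivity of the square of \<open>L - S\<close>.\<close>
  have sq: "?D (\<lambda>X Y. (L X Y - S X Y)\<^sup>2) = ?D (\<lambda>X Y. L X Y * L X Y) - 2 * ?D (\<lambda>X Y. L X Y * S X Y) + ?D (\<lambda>X Y. S X Y * S X Y)"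
    for L S :: "'a set \<Rightarrow> 'a set \<Rightarrow> real"
    unfolding bexp_cmult[symmetric] bexp_add[symmetric] bexp_diff[symmetric]
    by (intro bexp_cong) (simp add: power2_eq_square algebra_simps)
  have "0 \<le> ?D (\<lambda>X Y. (?L X Y - ?S X Y)\<^sup>2)"
    by (intro bexp_nonneg mult_nonneg_nonneg h k zero_le_power2) auto
  also have "\<dots> = ?D (\<lambda>X Y. ?L X Y * ?L X Y) - 2 * ?D (\<lambda>X Y. ?L X Y * ?S X Y) + ?D (\<lambda>X Y. ?S X Y * ?S X Y)"
    by (rule sq)
  also have "?D (\<lambda>X Y. ?L X Y * ?L X Y) = real (card J) + Q"
    unfolding uexp_bilinear sum_split_diagonal[OF J]
    by (simp add: h1 k1 Q_def)
  also have "?D (\<lambda>X Y. ?L X Y * ?S X Y) = \<Delta> + U"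
    unfolding uexp_bilinear sum_split_diagonal[OF J]
    using H K by (intro arg_cong2[where f = "(+)"]) (simp_all add: se se' ee ee' HO KO U_def \<Delta>_def)
  also have "?D (\<lambda>X Y. ?S X Y * ?S X Y) = \<Delta>"
    unfolding uexp_bilinear sum_split_diagonal[OF J]
    by (simp add: ee ee' HO KO \<Delta>_def)
  finally have main: "Q \<ge> \<Delta> - real (card J) + 2 * U" by simp
  have "\<Delta> - real (card J) = (\<Sum>j\<in>J. d j * d' j - d j - d' j)"
    by (simp add: \<Delta>_def sum_subtractf sum.distrib algebra_simps)
  also have "\<dots> \<ge> (\<Sum>j\<in>J. - d j - d' j)"
    using d0 by (intro sum_mono) simp
  finally have D: "\<Delta> - real (card J) \<ge> - (\<Sum>j\<in>J. d j) - (\<Sum>j\<in>J. d' j)"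
    by (simp add: sum_subtractf sum_negf)
  have bes: "(\<Sum>l\<in>J - {j}. (u j l)\<^sup>2) \<le> d j" "(\<Sum>l\<in>J - {j}. (u' j l)\<^sup>2) \<le> d' j" if "j \<in> J" for j
    unfolding u_def d_def u'_def d'_def using J h k H K ee ee' d0
    by (auto intro!: bessel)
  have "- 2 * U \<le> (\<Sum>j\<in>J. \<Sum>l\<in>J - {j}. (u j l)\<^sup>2 + (u' j l)\<^sup>2)"
    unfolding U_def sum_distrib_left
  proof (intro sum_mono)
    fix j l
    show "- 2 * (u j l * u' j l) \<le> (u j l)\<^sup>2 + (u' j l)\<^sup>2"
      using zero_le_power2[of "u j l + u' j l"] by (simp add: power2_sum)
  qed
  also have "\<dots> \<le> (\<Sum>j\<in>J. d j + d' j)"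
    using bes by (intro sum_mono) (auto simp: sum.distrib intro: add_mono)
  finally have "2 * U \<ge> - (\<Sum>j\<in>J. d j) - (\<Sum>j\<in>J. d' j)" by (simp add: sum.distrib)
  then show ?thesis using main D H K unfolding Q_def[symmetric] by argo
qed

text \<open>Jensen's inequality for \<open>ln\<close> under the density \<open>h\<close>, proved by
  integrating the tangent bound \<open>ln z <= z - 1\<close> at \<open>z = h X / ?s\<close>; the
  correction terms cancel because \<open>h\<close> has mean 1. Positivity of the second moment comes
  from the variance of \<open>h\<close>.\<close>

lemma entropy_le_ln_second_moment:
  assumes J: "finite J" and h: "\<And>X. X \<subseteq> J \<Longrightarrow> 0 \<le> h X" and h1: "uexp J h = 1"
  shows "0 < uexp J (\<lambda>X. (h X)\<^sup>2)"
    and "uexp J (\<lambda>X. h X * ln (h X)) \<le> ln (uexp J (\<lambda>X. (h X)\<^sup>2))"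
proof -
  let ?s = "uexp J (\<lambda>X. (h X)\<^sup>2)"
  have "0 \<le> uexp J (\<lambda>X. (h X - 1)\<^sup>2)" by (intro bexp_nonneg) auto
  also have "(\<lambda>X. (h X - 1)\<^sup>2) = (\<lambda>X. (h X)\<^sup>2 - 2 * h X + 1)"
    by (rule ext) (simp add: power2_eq_square algebra_simps)
  also have "uexp J \<dots> = ?s - 1" using J h1 by (simp add: bexp_add bexp_diff bexp_cmult)
  finally show s: "0 < ?s" by simp
  have "uexp J (\<lambda>X. h X * ln (h X)) \<le> uexp J (\<lambda>X. h X * (ln ?s - 1) + (h X)\<^sup>2 * (1 / ?s))"
  proof (rule bexp_mono)
    fix X assume X: "X \<subseteq> J"
    show "h X * ln (h X) \<le> h X * (ln ?s - 1) + (h X)\<^sup>2 * (1 / ?s)"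
    proof (cases "h X = 0")
      case False
      then have hX: "0 < h X" using h[OF X] by simp
      have "ln (h X / ?s) \<le> h X / ?s - 1" using hX s by (intro ln_le_minus_one) simp
      then have "ln (h X) \<le> ln ?s - 1 + h X / ?s" using hX s by (simp add: ln_div)
      then have "h X * ln (h X) \<le> h X * (ln ?s - 1 + h X / ?s)" using hX by (intro mult_left_mono) auto
      then show ?thesis by (simp add: power2_eq_square algebra_simps)
    qed simp
  qed auto
  also have "\<dots> = ln ?s" unfolding bexp_add bexp_multc h1 using s by simp
  finally show "uexp J (\<lambda>X. h X * ln (h X)) \<le> ln ?s" .
qed

text \<open>The free parameter \<open>v\<close> replaces a bound in terms of the concave function \<open>w ln (e / w)\<close> by its
  tangents, so that averaging needs no Jensen inequality.\<close>

lemma level2_pairing_lower_scaled: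
  assumes J: "finite J" and h: "\<And>X. X \<subseteq> J \<Longrightarrow> 0 \<le> h X" and k: "\<And>X. X \<subseteq> J \<Longrightarrow> 0 \<le> k X"
    and v: "0 < v"
  shows "- 8 * (v * (uexp J (\<lambda>X. (h X)\<^sup>2) + uexp J (\<lambda>X. (k X)\<^sup>2)) / 2 - uexp J h * uexp J k * ln v)
    \<le> (\<Sum>j\<in>J. \<Sum>l\<in>J - {j}. uexp J (\<lambda>X. h X * (sg j X * sg l X)) * uexp J (\<lambda>X. k X * (sg j X * sg l X)))"
    (is "- 8 * (v * (?A + ?B) / 2 - ?a * ?b * ln v) \<le> ?Q")
proof -
  have nn: "0 \<le> ?A" "0 \<le> ?B" "0 \<le> ?a" "0 \<le> ?b"
    by (intro bexp_nonneg h k zero_le_power2; simp)+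
  show ?thesis
  proof (cases "?a = 0 \<or> ?b = 0")
    case True
    then have "?Q = 0"
    proof
      assume z: "?a = 0"
      have "h X = 0" if "X \<subseteq> J" for X by (rule uexp_eq_zeroD[OF J h z that])
      then have "uexp J (\<lambda>X. h X * (sg j X * sg l X)) = uexp J (\<lambda>X. 0)" for j l
        by (intro bexp_cong) simp
      then show ?thesis by simp
    next
      assume z: "?b = 0"
      have "k X = 0" if "X \<subseteq> J" for X by (rule uexp_eq_zeroD[OF J k z that])
      then have "uexp J (\<lambda>X. k X * (sg j X * sg l X)) = uexp J (\<lambda>X. 0)" for j l
        by (intro bexp_cong) simp
      then show ?thesis by simp
    qed
    moreover have "0 \<le> v * (?A + ?B) / 2" using v nn by simp
    moreover have "?a * ?b * ln v = 0" using True by auto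
    moreover have "- 8 * (P - R) \<le> Q" if "Q = 0" "0 \<le> P" "R = 0" for P Q R :: real
      using that by simp
    ultimately show ?thesis by blast
  next
    case False
    then have ab: "0 < ?a" "0 < ?b" using nn by auto
    define h' where "h' X = h X * (1 / ?a)" for X
    define k' where "k' X = k X * (1 / ?b)" for X
    have h': "0 \<le> h' X" and k': "0 \<le> k' X" if "X \<subseteq> J" for X
      using h k ab that by (auto simp: h'_def k'_def)
    have h'1: "uexp J h' = 1" and k'1: "uexp J k' = 1"
      unfolding h'_def k'_def bexp_multc using ab by auto
    have h'2: "uexp J (\<lambda>X. (h' X)\<^sup>2) = ?A / ?a\<^sup>2" and k'2: "uexp J (\<lambda>X. (k' X)\<^sup>2) = ?B / ?b\<^sup>2"
      unfolding h'_def k'_def power_mult_distrib bexp_multc by (auto simp: power_divide)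
    have A: "0 < ?A"
      using entropy_le_ln_second_moment(1)[OF J h' h'1] ab unfolding h'2 by (simp add: zero_less_divide_iff)
    have B: "0 < ?B"
      using entropy_le_ln_second_moment(1)[OF J k' k'1] ab unfolding k'2 by (simp add: zero_less_divide_iff)
    have eA: "uexp J (\<lambda>X. h' X * ln (h' X)) \<le> ln (?A / ?a\<^sup>2)"
      using entropy_le_ln_second_moment(2)[OF J h' h'1] unfolding h'2 by simp
    have eB: "uexp J (\<lambda>X. k' X * ln (k' X)) \<le> ln (?B / ?b\<^sup>2)"
      using entropy_le_ln_second_moment(2)[OF J k' k'1] unfolding k'2 by simp
    define p where "p = ?a * ?b"
    define r where "r = (?A + ?B) / 2"
    have p: "0 < p" and r: "0 < r" using ab A B by (auto simp: p_def r_def)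
    have AB: "?A * ?B \<le> r\<^sup>2"
      using zero_le_power2[of "?A - ?B"] by (simp add: r_def power2_eq_square field_simps)
    have Q: "?Q = p * (\<Sum>j\<in>J. \<Sum>l\<in>J - {j}. uexp J (\<lambda>X. h' X * (sg j X * sg l X)) * uexp J (\<lambda>X. k' X * (sg j X * sg l X)))"
    proof -
      have "uexp J (\<lambda>X. h X * (sg j X * sg l X)) = ?a * uexp J (\<lambda>X. h' X * (sg j X * sg l X))"
        "uexp J (\<lambda>X. k X * (sg j X * sg l X)) = ?b * uexp J (\<lambda>X. k' X * (sg j X * sg l X))" for j l
        unfolding bexp_cmult[symmetric] using ab by (auto simp: h'_def k'_def)
      then show ?thesis by (simp add: p_def sum_distrib_left mult_ac)
    qed
    have "p * (ln (?A / ?a\<^sup>2) + ln (?B / ?b\<^sup>2)) = p * ln (?A * ?B / p\<^sup>2)"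
      using A B ab by (simp add: p_def ln_mult ln_div power_mult_distrib)
    also have "\<dots> \<le> p * ln (r\<^sup>2 / p\<^sup>2)"
      using A B AB p r by (intro mult_left_mono ln_mono divide_right_mono) auto
    \<comment> \<open>The parameter \<open>v\<close> enters by writing \<open>r / p\<close> as
      \<open>(r * v / p) / v\<close>; the tangent \<open>ln z <= z - 1\<close> at
      \<open>z = r * v / p\<close> then makes the bound linear in \<open>r\<close>.\<close>
    also have "\<dots> = 2 * (p * ln (r * v / p)) - 2 * (p * ln v)"
      using p r v by (simp add: ln_mult ln_div ln_realpow algebra_simps)
    also have "\<dots> \<le> 2 * (p * (r * v / p - 1)) - 2 * (p * ln v)"
      using p r v by (intro diff_right_mono mult_left_mono ln_le_minus_one) auto
    also have "\<dots> \<le> 2 * (v * r - p * ln v)"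
      using p by (simp add: algebra_simps)
    finally have E: "p * (ln (?A / ?a\<^sup>2) + ln (?B / ?b\<^sup>2)) \<le> 2 * (v * r - p * ln v)" .
    have "- 8 * (v * r - p * ln v) \<le> p * (- 4 * (ln (?A / ?a\<^sup>2) + ln (?B / ?b\<^sup>2)))"
      using E by (simp add: algebra_simps)
    also have "\<dots> \<le> p * (- 4 * (uexp J (\<lambda>X. h' X * ln (h' X)) + uexp J (\<lambda>X. k' X * ln (k' X))))"
      using p eA eB by (intro mult_left_mono[of _ _ p]) auto
    also have "\<dots> \<le> ?Q"
      unfolding Q using p by (intro mult_left_mono level2_pairing_lower[OF J h' k' h'1 k'1]) auto
    finally show ?thesis by (simp add: p_def r_def)
  qed
qed

section \<open>The third Fourier level of increasing functions\<close>

lemma uexp_chi: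
  assumes "finite V" "S \<subseteq> V" "S \<noteq> {}"
  shows "uexp V (chi S) = 0"
proof -
  obtain a where a: "a \<in> S" using assms by auto
  define V' S' where "V' = V - {a}" and "S' = S - {a}"
  have V: "V = insert a V'" "a \<notin> V'" "finite V'" "S = insert a S'" "a \<notin> S'" "finite S'"
    using assms a by (auto simp: V'_def S'_def finite_subset)
  have "uexp V' (chi S) = uexp V' (\<lambda>X. - chi S' X)"
    using V by (intro bexp_cong) (auto simp: chi_insert_new sg_def)
  moreover have "uexp V' (\<lambda>X. chi S (insert a X)) = uexp V' (chi S')"
    using V by (intro bexp_cong) (simp add: chi_insert_new chi_insert_point sg_def)
  ultimately show ?thesis
    using V(2,3) by (subst V(1)) (simp add: bexp_insert bexp_uminus)
qed

lemma uexp_sg [simp]: "finite V \<Longrightarrow> i \<in> V \<Longrightarrow> uexp V (sg i) = 0"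
  using uexp_chi[of V "{i}"] by (simp add: chi_def cong: bexp_cong)

lemma uexp_sg2 [simp]:
  "finite V \<Longrightarrow> i \<in> V \<Longrightarrow> j \<in> V \<Longrightarrow> i \<noteq> j \<Longrightarrow> uexp V (\<lambda>X. sg i X * sg j X) = 0"
  using uexp_chi[of V "{i, j}"] by (simp add: chi_def fun_eq_iff cong: bexp_cong)

lemma uexp_sg3 [simp]:
  "finite V \<Longrightarrow> i \<in> V \<Longrightarrow> j \<in> V \<Longrightarrow> l \<in> V \<Longrightarrow> i \<noteq> j \<Longrightarrow> i \<noteq> l \<Longrightarrow> j \<noteq> l
    \<Longrightarrow> uexp V (\<lambda>X. sg i X * (sg j X * sg l X)) = 0"
  using uexp_chi[of V "{i, j, l}"] by (simp add: chi_def fun_eq_iff cong: bexp_cong)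

lemma uexp_mult_sg_nonneg:
  assumes "finite I" "i \<in> I" "mono_on (Pow I) f"
  shows "0 \<le> uexp I (\<lambda>X. f X * sg i X)"
proof -
  define I' where "I' = I - {i}"
  have I: "I = insert i I'" "i \<notin> I'" "finite I'" using assms by (auto simp: I'_def)
  have "uexp I' f \<le> uexp I' (\<lambda>X. f (insert i X))"
    using assms(3) I by (intro bexp_mono monotone_onD[OF assms(3)]) auto
  moreover have "uexp I' (\<lambda>X. f X * sg i X) = uexp I' (\<lambda>X. - f X)"
    using I by (intro bexp_cong) (auto simp: sg_def)
  ultimately show ?thesis
    using I by (simp add: bexp_insert bexp_uminus) (simp add: sg_def)
qed

lemma sum_level1_le:
  assumes "finite I"
  shows "(\<Sum>i\<in>I. (uexp I (\<lambda>X. f X * sg i X))\<^sup>2) \<le> uexp I (\<lambda>X. (f X)\<^sup>2)"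
  using bessel[of I I "\<lambda>_. 1" sg f] assms by simp

definition coeff_prod :: "'a set \<Rightarrow> ('a set \<Rightarrow> real) \<Rightarrow> ('a set \<Rightarrow> real) \<Rightarrow> 'a set \<Rightarrow> real" where
  "coeff_prod V f g S = fcoeff V f S * fcoeff V g S"

text \<open>Averaging \<open>f\<close> against \<open>x\<^sub>i\<close> over the coordinates in \<open>I\<close> yields functions of the coordinates in \<open>V - I\<close>
  whose squares sum to at most one over \<open>i \<in> I\<close>; this fails for the derivatives themselves and is the
  reason for splitting \<open>V\<close>.\<close>

lemma third_level_split:
  assumes V: "finite V" "I \<subseteq> V"
    and f: "mono_on (Pow V) f" "\<And>X. X \<subseteq> V \<Longrightarrow> \<bar>f X\<bar> \<le> 1"
    and g: "mono_on (Pow V) g" "\<And>X. X \<subseteq> V \<Longrightarrow> \<bar>g X\<bar> \<le> 1"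
    and v: "0 < v"
  shows "- 8 * (v - (\<Sum>i\<in>I. coeff_prod V f g {i}) * ln v)
    \<le> (\<Sum>i\<in>I. \<Sum>j\<in>V - I. \<Sum>l\<in>V - I - {j}. coeff_prod V f g {i, j, l})"
proof -
  define J where "J = V - I"
  have fin: "finite I" "finite J" and VJI: "V = J \<union> I" "J \<inter> I = {}"
    using V by (auto simp: J_def finite_subset)
  \<comment> \<open>The degree-one coefficient at \<open>i\<close> of \<open>f\<close> with the
    coordinates in \<open>J\<close> fixed to \<open>X\<close>. Monotonicity makes it nonnegative, so
    it can serve as a weight in the second-level bound, and its level-two coefficients are
    third-level coefficients of \<open>f\<close>.\<close>
  define H where "H f i X = uexp I (\<lambda>Y. f (X \<union> Y) * sg i Y)" for f :: "'a set \<Rightarrow> real" and i X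
  have H0: "0 \<le> H f i X" if "mono_on (Pow V) f" "X \<subseteq> J" "i \<in> I" for f i X
  proof -
    have "mono_on (Pow I) (\<lambda>Y. f (X \<union> Y))"
      using that V VJI by (intro monotone_onI monotone_onD[OF that(1)]) auto
    then show ?thesis using uexp_mult_sg_nonneg[OF fin(1) that(3)] by (simp add: H_def)
  qed
  have H2: "(\<Sum>i\<in>I. uexp J (\<lambda>X. (H f i X)\<^sup>2)) \<le> 1" if "\<And>X. X \<subseteq> V \<Longrightarrow> \<bar>f X\<bar> \<le> 1" for f
  proof -
    have "(\<Sum>i\<in>I. (H f i X)\<^sup>2) \<le> 1" if "X \<subseteq> J" for X
    proof -
      have "(\<Sum>i\<in>I. (H f i X)\<^sup>2) \<le> uexp I (\<lambda>Y. (f (X \<union> Y))\<^sup>2)"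
        unfolding H_def by (rule sum_level1_le[OF fin(1)])
      also have "\<dots> \<le> uexp I (\<lambda>Y. 1)"
      proof (rule bexp_mono)
        fix Y assume "Y \<subseteq> I"
        then have "X \<union> Y \<subseteq> V" using that VJI by blast
        then show "(f (X \<union> Y))\<^sup>2 \<le> 1"
          using \<open>\<And>X. X \<subseteq> V \<Longrightarrow> \<bar>f X\<bar> \<le> 1\<close> by (simp add: abs_square_le_1)
      qed auto
      finally show ?thesis using fin by simp
    qed
    then have "uexp J (\<lambda>X. \<Sum>i\<in>I. (H f i X)\<^sup>2) \<le> uexp J (\<lambda>X. 1)" by (intro bexp_mono) auto
    then show ?thesis using fin by (simp add: bexp_sum)
  qed
  have c1: "uexp J (H f i) = fcoeff V f {i}" if "i \<in> I" for f i
    unfolding H_def fcoeff_def VJI(1) bexp_Un[OF fin(2,1) VJI(2)]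
    using that VJI by (intro bexp_cong) (auto simp: chi_def sg_def)
  have c3: "uexp J (\<lambda>X. H f i X * (sg j X * sg l X)) = fcoeff V f {i, j, l}"
    if "i \<in> I" "j \<in> J" "l \<in> J" "l \<noteq> j" for f i j l
  proof -
    have "i \<noteq> j" "i \<noteq> l" using that VJI by auto
    then show ?thesis
      unfolding H_def fcoeff_def VJI(1) bexp_Un[OF fin(2,1) VJI(2)] bexp_multc[symmetric]
      using that VJI by (intro bexp_cong) (auto simp: chi_def sg_def)
  qed
  let ?r = "\<lambda>i. (uexp J (\<lambda>X. (H f i X)\<^sup>2) + uexp J (\<lambda>X. (H g i X)\<^sup>2)) / 2"
  have r1: "(\<Sum>i\<in>I. ?r i) \<le> 1"
    using H2[of f, OF f(2)] H2[of g, OF g(2)] by (simp add: sum.distrib flip: sum_divide_distrib)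
  \<comment> \<open>The total second moment is at most 1 and enters with a negative sign, so
    replacing it by 1 only lowers the bound. One value of \<open>v\<close> serves all
    \<open>i\<close>.\<close>
  have "- 8 * (v - (\<Sum>i\<in>I. coeff_prod V f g {i}) * ln v)
      \<le> - 8 * (v * (\<Sum>i\<in>I. ?r i) - (\<Sum>i\<in>I. coeff_prod V f g {i}) * ln v)"
    using mult_left_mono[OF r1, of v] v by simp
  also have "\<dots> = (\<Sum>i\<in>I. - 8 * (v * (uexp J (\<lambda>X. (H f i X)\<^sup>2) + uexp J (\<lambda>X. (H g i X)\<^sup>2)) / 2
        - uexp J (H f i) * uexp J (H g i) * ln v))"
    unfolding sum_distrib_left sum_distrib_right sum_subtractf[symmetric]
    by (intro sum.cong refl) (simp add: c1 coeff_prod_def)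
  also have "\<dots> \<le> (\<Sum>i\<in>I. \<Sum>j\<in>J. \<Sum>l\<in>J - {j}. uexp J (\<lambda>X. H f i X * (sg j X * sg l X)) * uexp J (\<lambda>X. H g i X * (sg j X * sg l X)))"
    by (intro sum_mono level2_pairing_lower_scaled fin v H0 f(1) g(1))
  also have "\<dots> = (\<Sum>i\<in>I. \<Sum>j\<in>J. \<Sum>l\<in>J - {j}. coeff_prod V f g {i, j, l})"
    by (intro sum.cong refl) (simp add: c3 coeff_prod_def)
  finally show ?thesis by (simp add: J_def)
qed

text \<open>The split bound is averaged over a uniformly random \<open>I\<close>: an index lies in
  \<open>I\<close> with probability 1/2, and a triple has \<open>i\<close> inside and
  \<open>j\<close>, \<open>l\<close> outside with probability 1/8. Multiplying by 8 turns 8 into 64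
  and 8/2 into 32.\<close>

lemma third_level_lower:
  assumes V: "finite V"
    and f: "mono_on (Pow V) f" "\<And>X. X \<subseteq> V \<Longrightarrow> \<bar>f X\<bar> \<le> 1"
    and g: "mono_on (Pow V) g" "\<And>X. X \<subseteq> V \<Longrightarrow> \<bar>g X\<bar> \<le> 1"
    and v: "0 < v"
  shows "- 64 * v + 32 * (\<Sum>i\<in>V. coeff_prod V f g {i}) * ln v
    \<le> (\<Sum>i\<in>V. \<Sum>j\<in>V - {i}. \<Sum>l\<in>V - {i, j}. coeff_prod V f g {i, j, l})"
proof -
  let ?c = "coeff_prod V f g"
  let ?p = "\<lambda>i I. (1 + sg i I) / 2" and ?n = "\<lambda>i I. (1 - sg i I) / 2"
  have 1: "uexp V (?p i) = 1 / 2" if "i \<in> V" for i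
    using V that by (simp add: add_divide_distrib bexp_add bexp_multc[where c = "1/2", simplified])
  have 3: "uexp V (\<lambda>I. ?p i I * ?n j I * ?n l I) = 1 / 8"
    if "i \<in> V" "j \<in> V - {i}" "l \<in> V - {i, j}" for i j l
  proof -
    have "(\<lambda>I. ?p i I * ?n j I * ?n l I) = (\<lambda>I. (1 + sg i I - sg j I - sg l I - sg i I * sg j I
        - sg i I * sg l I + sg j I * sg l I + sg i I * (sg j I * sg l I)) * (1 / 8))"
      by (rule ext) (simp add: field_simps)
    moreover have "i \<noteq> j" "i \<noteq> l" "j \<noteq> l" using that by auto
    ultimately show ?thesis using that V
      by (simp only: bexp_multc) (simp add: bexp_add bexp_diff)
  qed
  have sum1: "(\<Sum>i\<in>I. ?c {i}) = (\<Sum>i\<in>V. ?p i I * ?c {i})" if "I \<subseteq> V" for I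
    using V that by (intro sum.mono_neutral_cong_left) (auto simp: sg_def)
  have sum3: "(\<Sum>i\<in>I. \<Sum>j\<in>V - I. \<Sum>l\<in>V - I - {j}. ?c {i, j, l})
      = (\<Sum>i\<in>V. \<Sum>j\<in>V - {i}. \<Sum>l\<in>V - {i, j}. ?p i I * ?n j I * ?n l I * ?c {i, j, l})" if "I \<subseteq> V" for I
  proof -
    have l: "(\<Sum>l\<in>V - I - {j}. ?c {i, j, l})
        = (\<Sum>l\<in>V - {i, j}. ?p i I * ?n j I * ?n l I * ?c {i, j, l})" if "i \<in> I" "j \<in> V - I" for i j
      by (rule sum.mono_neutral_cong_left) (use V that in \<open>auto simp: sg_def\<close>)
    have j: "(\<Sum>j\<in>V - I. \<Sum>l\<in>V - I - {j}. ?c {i, j, l})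
        = (\<Sum>j\<in>V - {i}. \<Sum>l\<in>V - {i, j}. ?p i I * ?n j I * ?n l I * ?c {i, j, l})" if "i \<in> I" for i
      by (rule sum.mono_neutral_cong_left) (use V that l[OF that] in \<open>auto simp: sg_def\<close>)
    show ?thesis
      by (rule sum.mono_neutral_cong_left) (use V that j in \<open>auto simp: sg_def\<close>)
  qed
  have "- 8 * (v - (\<Sum>i\<in>V. ?c {i}) * ln v / 2)
      = uexp V (\<lambda>I. - 8 * (v - (\<Sum>i\<in>V. ?p i I * ?c {i}) * ln v))"
    by (simp only: bexp_cmult bexp_diff bexp_multc bexp_sum bexp_const[OF V])
      (simp add: 1 bexp_multc sum_divide_distrib sum_distrib_right)
  also have "\<dots> \<le> uexp V (\<lambda>I. \<Sum>i\<in>V. \<Sum>j\<in>V - {i}. \<Sum>l\<in>V - {i, j}. ?p i I * ?n j I * ?n l I * ?c {i, j, l})"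
    using third_level_split[OF V _ f g v] sum1 sum3 by (intro bexp_mono) auto
  also have "\<dots> = (\<Sum>i\<in>V. \<Sum>j\<in>V - {i}. \<Sum>l\<in>V - {i, j}. 1 / 8 * ?c {i, j, l})"
    unfolding bexp_sum bexp_multc by (intro sum.cong refl arg_cong2[where f = "(*)"] 3)
  also have "\<dots> = 1 / 8 * (\<Sum>i\<in>V. \<Sum>j\<in>V - {i}. \<Sum>l\<in>V - {i, j}. ?c {i, j, l})"
    by (simp only: sum_distrib_left)
  finally show ?thesis by (simp add: mult_ac)
qed

section \<open>Random restrictions\<close>

definition set_poly :: "'a set \<Rightarrow> ('a set \<Rightarrow> real) \<Rightarrow> real \<Rightarrow> real" where
  "set_poly W c \<rho> = (\<Sum>T\<in>Pow W. \<rho> ^ card T * c T)"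

lemma set_poly_empty [simp]: "set_poly {} c \<rho> = c {}"
  by (simp add: set_poly_def)

lemma set_poly_insert:
  assumes "finite W" "a \<notin> W"
  shows "set_poly (insert a W) c \<rho> = set_poly W c \<rho> + \<rho> * set_poly W (\<lambda>T. c (insert a T)) \<rho>"
proof -
  have inj: "inj_on (insert a) (Pow W)" using assms by (auto simp: inj_on_def)
  have "set_poly (insert a W) c \<rho> = set_poly W c \<rho> + (\<Sum>T\<in>insert a ` Pow W. \<rho> ^ card T * c T)"
    unfolding set_poly_def Pow_insert using assms by (intro sum.union_disjoint) auto
  also have "(\<Sum>T\<in>insert a ` Pow W. \<rho> ^ card T * c T) = \<rho> * set_poly W (\<lambda>T. c (insert a T)) \<rho>"
    unfolding sum.reindex[OF inj] set_poly_def sum_distrib_left o_def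
  proof (intro sum.cong refl)
    fix T assume "T \<in> Pow W"
    then have "card (insert a T) = Suc (card T)"
      using assms by (intro card_insert_disjoint) (auto intro: finite_subset)
    then show "\<rho> ^ card (insert a T) * c (insert a T) = \<rho> * (\<rho> ^ card T * c (insert a T))" by simp
  qed
  finally show ?thesis .
qed

lemma set_poly_cong: "(\<And>T. T \<subseteq> W \<Longrightarrow> c T = c' T) \<Longrightarrow> set_poly W c \<rho> = set_poly W c' \<rho>"
  unfolding set_poly_def by (intro sum.cong) auto

lemma set_poly_0 [simp]: "finite W \<Longrightarrow> set_poly W c 0 = c {}"
  by (induction W rule: finite_induct) (simp_all add: set_poly_insert)

lemma set_poly_1: "set_poly W c 1 = (\<Sum>T\<in>Pow W. c T)"
  by (simp add: set_poly_def)

text \<open>The polynomial is the diagonal value of a multi-affine one with a variable for each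
  element of \<open>W\<close>; the summand for \<open>j\<close> is the partial derivative in that
  variable.\<close>

lemma has_real_derivative_set_poly:
  assumes "finite W"
  shows "(set_poly W c has_real_derivative (\<Sum>j\<in>W. set_poly (W - {j}) (\<lambda>T. c (insert j T)) \<rho>)) (at \<rho>)"
  using assms
proof (induction W arbitrary: c rule: finite_induct)
  case empty
  then show ?case by (simp add: set_poly_def[abs_def])
next
  case (insert a W)
  have eq: "set_poly (insert a W) c = (\<lambda>\<rho>. set_poly W c \<rho> + \<rho> * set_poly W (\<lambda>T. c (insert a T)) \<rho>)"
    using insert.hyps by (intro ext set_poly_insert)
  have "set_poly (insert a W - {j}) (\<lambda>T. c (insert j T)) \<rho>
      = set_poly (W - {j}) (\<lambda>T. c (insert j T)) \<rho> + \<rho> * set_poly (W - {j}) (\<lambda>T. c (insert a (insert j T))) \<rho>"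
    if "j \<in> W" for j
  proof -
    have "insert a W - {j} = insert a (W - {j})" using that insert.hyps by auto
    then show ?thesis using insert.hyps by (simp add: set_poly_insert insert_commute)
  qed
  then have "(\<Sum>j\<in>insert a W. set_poly (insert a W - {j}) (\<lambda>T. c (insert j T)) \<rho>)
    = (\<Sum>j\<in>W. set_poly (W - {j}) (\<lambda>T. c (insert j T)) \<rho>)
      + (set_poly W (\<lambda>T. c (insert a T)) \<rho> + \<rho> * (\<Sum>j\<in>W. set_poly (W - {j}) (\<lambda>T. c (insert a (insert j T))) \<rho>))"
    using insert.hyps by (simp add: sum.distrib sum_distrib_left)
  then show ?case unfolding eq
    by (auto intro!: derivative_eq_intros insert.IH)
qed

text \<open>The coordinates in \<open>R\<close> are frozen at their values in \<open>Z\<close>. The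
  result is still regarded as a function on the whole cube, so its coefficients are taken over the
  same \<open>V\<close>; those at sets meeting \<open>R\<close> vanish.\<close>

definition restr :: "'a set \<Rightarrow> 'a set \<Rightarrow> ('a set \<Rightarrow> real) \<Rightarrow> 'a set \<Rightarrow> real" where
  "restr R Z f X = f (Z \<inter> R \<union> (X - R))"

lemma fcoeff_add: "fcoeff V (\<lambda>X. f X + g X) S = fcoeff V f S + fcoeff V g S"
  by (simp add: fcoeff_def distrib_right bexp_add)

lemma fcoeff_diff: "fcoeff V (\<lambda>X. f X - g X) S = fcoeff V f S - fcoeff V g S"
  by (simp add: fcoeff_def left_diff_distrib bexp_diff)

lemma fcoeff_cmult: "fcoeff V (\<lambda>X. c * f X) S = c * fcoeff V f S"
  by (simp add: fcoeff_def mult.assoc bexp_cmult)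

lemma fcoeff_half: "fcoeff V (\<lambda>X. f X / 2) S = fcoeff V f S / 2"
  using fcoeff_cmult[of V "1/2" f S] by simp

text \<open>The restricted coefficient at \<open>S\<close> is zero if \<open>R\<close> meets
  \<open>S\<close>, and otherwise the sum over \<open>T \<subseteq> R\<close> of
  \<open>fcoeff V f (S \<union> T) * chi T Z\<close>. Averaging the product over \<open>Z\<close>
  leaves the diagonal terms in \<open>T\<close>, and \<open>R\<close> avoids \<open>S\<close> and
  contains \<open>T\<close> with probability \<open>(1 - \<rho>) ^ card S * \<rho> ^ card T\<close>.
  The induction does this one coordinate at a time.\<close>

lemma restriction_expectation:
  assumes "finite V" "S \<subseteq> V"
  shows "bexp \<rho> V (\<lambda>R. uexp V (\<lambda>Z. coeff_prod V (restr R Z f) (restr R Z g) S))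
    = (1 - \<rho>) ^ card S * set_poly (V - S) (\<lambda>T. coeff_prod V f g (S \<union> T)) \<rho>"
  using assms
proof (induction V arbitrary: f g S rule: finite_induct)
  case empty
  then show ?case by (simp add: restr_def coeff_prod_def)
next
  case (insert a V)
  let ?G = "\<lambda>f g S. bexp \<rho> V (\<lambda>R. uexp V (\<lambda>Z. coeff_prod V (restr R Z f) (restr R Z g) S))"
  have fin: "finite S" using insert.prems insert.hyps by (auto intro: finite_subset)
  define p where "p f X = f (insert a X)" for f :: "'a set \<Rightarrow> real" and X
  have r: "restr (insert a R) (insert a Z) f (insert a X) = restr R Z (p f) X"
     "restr (insert a R) (insert a Z) f X = restr R Z (p f) X"
     "restr (insert a R) Z f (insert a X) = restr R Z f X"
     "restr (insert a R) Z f X = restr R Z f X"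
     "restr R (insert a Z) f (insert a X) = restr R Z (p f) X"
     "restr R (insert a Z) f X = restr R Z f X"
     "restr R Z f (insert a X) = restr R Z (p f) X"
    if "R \<subseteq> V" "Z \<subseteq> V" "X \<subseteq> V" for R Z X f
  proof -
    have a: "a \<notin> R" "a \<notin> Z" "a \<notin> X" using that insert.hyps by auto
    have "insert a Z \<inter> insert a R \<union> (insert a X - insert a R) = insert a (Z \<inter> R \<union> (X - R))"
      "insert a Z \<inter> insert a R \<union> (X - insert a R) = insert a (Z \<inter> R \<union> (X - R))"
      "Z \<inter> insert a R \<union> (insert a X - insert a R) = Z \<inter> R \<union> (X - R)"
      "Z \<inter> insert a R \<union> (X - insert a R) = Z \<inter> R \<union> (X - R)"
      "insert a Z \<inter> R \<union> (insert a X - R) = insert a (Z \<inter> R \<union> (X - R))"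
      "insert a Z \<inter> R \<union> (X - R) = Z \<inter> R \<union> (X - R)"
      "Z \<inter> R \<union> (insert a X - R) = insert a (Z \<inter> R \<union> (X - R))"
      using a by auto
    then show "restr (insert a R) (insert a Z) f (insert a X) = restr R Z (p f) X"
     "restr (insert a R) (insert a Z) f X = restr R Z (p f) X"
     "restr (insert a R) Z f (insert a X) = restr R Z f X"
     "restr (insert a R) Z f X = restr R Z f X"
     "restr R (insert a Z) f (insert a X) = restr R Z (p f) X"
     "restr R (insert a Z) f X = restr R Z f X"
     "restr R Z f (insert a X) = restr R Z (p f) X"
      by (simp_all add: restr_def p_def)
  qed
  show ?case
  proof (cases "a \<in> S")
    case False
    define m where "m f X = (p f X + f X) / 2" for f :: "'a set \<Rightarrow> real" and X
    have SV: "S \<subseteq> V" using insert.prems False by auto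
    have c: "fcoeff (insert a V) (restr (insert a R) (insert a Z) f) S = fcoeff V (restr R Z (p f)) S"
      "fcoeff (insert a V) (restr (insert a R) Z f) S = fcoeff V (restr R Z f) S"
      "fcoeff (insert a V) (restr R (insert a Z) f) S = fcoeff V (restr R Z (m f)) S"
      "fcoeff (insert a V) (restr R Z f) S = fcoeff V (restr R Z (m f)) S"
      if RZ: "R \<subseteq> V" "Z \<subseteq> V" for R Z f
    proof -
      have "fcoeff V (restr R Z (m f)) S = (fcoeff V (restr R Z (p f)) S + fcoeff V (restr R Z f) S) / 2"
        by (simp add: restr_def[abs_def] m_def fcoeff_half fcoeff_add)
      then show "fcoeff (insert a V) (restr (insert a R) (insert a Z) f) S = fcoeff V (restr R Z (p f)) S"
      "fcoeff (insert a V) (restr (insert a R) Z f) S = fcoeff V (restr R Z f) S"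
      "fcoeff (insert a V) (restr R (insert a Z) f) S = fcoeff V (restr R Z (m f)) S"
      "fcoeff (insert a V) (restr R Z f) S = fcoeff V (restr R Z (m f)) S"
        unfolding fcoeff_insert_notin[OF insert.hyps False]
        using r[OF RZ] by (simp_all cong: fcoeff_cong)
    qed
    have "bexp \<rho> (insert a V) (\<lambda>R. uexp (insert a V) (\<lambda>Z. coeff_prod (insert a V) (restr R Z f) (restr R Z g) S))
      = \<rho> * bexp \<rho> V (\<lambda>R. (uexp V (\<lambda>Z. coeff_prod V (restr R Z (p f)) (restr R Z (p g)) S) + uexp V (\<lambda>Z. coeff_prod V (restr R Z f) (restr R Z g) S)) / 2)
        + (1 - \<rho>) * ?G (m f) (m g) S"
      unfolding bexp_insert[OF insert.hyps]
      by (intro arg_cong2[where f = "(+)"] arg_cong2[where f = "(*)"] refl bexp_cong)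
        (simp_all add: coeff_prod_def c cong: bexp_cong)
    also have "\<dots> = \<rho> * ((?G (p f) (p g) S + ?G f g S) / 2) + (1 - \<rho>) * ?G (m f) (m g) S"
      by (simp add: bexp_add bexp_multc[where c = "1/2", simplified])
    also have "\<dots> = (1 - \<rho>) ^ card S * (\<rho> * ((set_poly (V - S) (\<lambda>T. coeff_prod V (p f) (p g) (S \<union> T)) \<rho>
        + set_poly (V - S) (\<lambda>T. coeff_prod V f g (S \<union> T)) \<rho>) / 2)
        + (1 - \<rho>) * set_poly (V - S) (\<lambda>T. coeff_prod V (m f) (m g) (S \<union> T)) \<rho>)"
      unfolding insert.IH[OF SV] by (simp add: algebra_simps add_divide_distrib)
    \<comment> \<open>If \<open>u\<close>, \<open>w\<close> are the coefficients of the halves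
      \<open>p f\<close>, \<open>f\<close> and \<open>u'\<close>, \<open>w'\<close> those of
      \<open>p g\<close>, \<open>g\<close>, then \<open>(u * u' + w * w') / 2\<close> is the product
      of the means plus the product of the half differences. The latter, weighted by \<rho>,
      supplies the sets containing \<open>a\<close>.\<close>
    also have "\<rho> * ((set_poly (V - S) (\<lambda>T. coeff_prod V (p f) (p g) (S \<union> T)) \<rho>
        + set_poly (V - S) (\<lambda>T. coeff_prod V f g (S \<union> T)) \<rho>) / 2)
        + (1 - \<rho>) * set_poly (V - S) (\<lambda>T. coeff_prod V (m f) (m g) (S \<union> T)) \<rho>
       = set_poly (insert a (V - S)) (\<lambda>T. coeff_prod (insert a V) f g (S \<union> T)) \<rho>"
    proof -
      have mean: "fcoeff V (m f) T = (fcoeff V (p f) T + fcoeff V f T) / 2" for f T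
        by (simp add: m_def[abs_def] fcoeff_half fcoeff_add)
      have ins: "fcoeff (insert a V) f (S \<union> T) = (fcoeff V (p f) (S \<union> T) + fcoeff V f (S \<union> T)) / 2"
        "fcoeff (insert a V) f (insert a (S \<union> T)) = (fcoeff V (p f) (S \<union> T) - fcoeff V f (S \<union> T)) / 2"
        if "T \<in> Pow (V - S)" for f T
      proof -
        have T: "a \<notin> S \<union> T" "finite (S \<union> T)"
          using that False insert.hyps fin by (auto intro: finite_subset)
        show "fcoeff (insert a V) f (S \<union> T) = (fcoeff V (p f) (S \<union> T) + fcoeff V f (S \<union> T)) / 2"
          "fcoeff (insert a V) f (insert a (S \<union> T)) = (fcoeff V (p f) (S \<union> T) - fcoeff V f (S \<union> T)) / 2"
          using fcoeff_insert_notin[OF insert.hyps T(1), of f] fcoeff_insert_in[OF insert.hyps T(2,1), of f]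
          by (simp_all add: p_def[abs_def])
      qed
      have "set_poly (insert a (V - S)) (\<lambda>T. coeff_prod (insert a V) f g (S \<union> T)) \<rho>
        = set_poly (V - S) (\<lambda>T. coeff_prod (insert a V) f g (S \<union> T)) \<rho>
          + \<rho> * set_poly (V - S) (\<lambda>T. coeff_prod (insert a V) f g (insert a (S \<union> T))) \<rho>"
        using insert.hyps by (simp add: set_poly_insert)
      then show ?thesis
        unfolding set_poly_def sum_distrib_left sum_divide_distrib sum.distrib[symmetric]
        by (auto simp: coeff_prod_def mean ins field_simps intro!: sum.cong)
    qed
    also have "insert a (V - S) = insert a V - S" using False by auto
    finally show ?thesis .
  next
    case True
    define S' where "S' = S - {a}"
    have S': "S = insert a S'" "a \<notin> S'" "finite S'" "S' \<subseteq> V"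
      using True fin insert.prems by (auto simp: S'_def)
    \<comment> \<open>For \<open>a\<close> in \<open>R\<close> the restricted function ignores
      \<open>a\<close>, so its coefficient at \<open>S\<close> is zero; otherwise the coefficient
      comes from half the difference of the two halves.\<close>
    define m where "m f X = (p f X - f X) / 2" for f :: "'a set \<Rightarrow> real" and X
    have c: "fcoeff (insert a V) (restr (insert a R) (insert a Z) f) S = 0"
      "fcoeff (insert a V) (restr (insert a R) Z f) S = 0"
      "fcoeff (insert a V) (restr R (insert a Z) f) S = fcoeff V (restr R Z (m f)) S'"
      "fcoeff (insert a V) (restr R Z f) S = fcoeff V (restr R Z (m f)) S'"
      if RZ: "R \<subseteq> V" "Z \<subseteq> V" for R Z f
    proof -
      have "fcoeff V (restr R Z (m f)) S' = (fcoeff V (restr R Z (p f)) S' - fcoeff V (restr R Z f) S') / 2"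
        by (simp add: restr_def[abs_def] m_def fcoeff_half fcoeff_diff)
      then show "fcoeff (insert a V) (restr (insert a R) (insert a Z) f) S = 0"
      "fcoeff (insert a V) (restr (insert a R) Z f) S = 0"
      "fcoeff (insert a V) (restr R (insert a Z) f) S = fcoeff V (restr R Z (m f)) S'"
      "fcoeff (insert a V) (restr R Z f) S = fcoeff V (restr R Z (m f)) S'"
        unfolding S'(1) fcoeff_insert_in[OF insert.hyps S'(3,2)]
        using r[OF RZ] by (simp_all cong: fcoeff_cong)
    qed
    have "bexp \<rho> (insert a V) (\<lambda>R. uexp (insert a V) (\<lambda>Z. coeff_prod (insert a V) (restr R Z f) (restr R Z g) S))
      = \<rho> * bexp \<rho> V (\<lambda>R. 0) + (1 - \<rho>) * ?G (m f) (m g) S'"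
      unfolding bexp_insert[OF insert.hyps]
      by (intro arg_cong2[where f = "(+)"] arg_cong2[where f = "(*)"] refl bexp_cong)
        (simp_all add: coeff_prod_def c cong: bexp_cong)
    also have "\<dots> = (1 - \<rho>) ^ card S * set_poly (V - S') (\<lambda>T. coeff_prod V (m f) (m g) (S' \<union> T)) \<rho>"
      unfolding insert.IH[OF S'(4)] using S' by simp
    also have "set_poly (V - S') (\<lambda>T. coeff_prod V (m f) (m g) (S' \<union> T)) \<rho>
      = set_poly (V - S') (\<lambda>T. coeff_prod (insert a V) f g (S \<union> T)) \<rho>"
    proof (rule set_poly_cong)
      fix T assume "T \<subseteq> V - S'"
      then have T: "a \<notin> S' \<union> T" "finite (S' \<union> T)"
        using insert.hyps S' by (auto intro: finite_subset)
      have half: "fcoeff V (m f) (S' \<union> T) = (fcoeff V (p f) (S' \<union> T) - fcoeff V f (S' \<union> T)) / 2" for f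
        by (simp add: m_def[abs_def] fcoeff_half fcoeff_diff)
      have "fcoeff V (m f) (S' \<union> T) = fcoeff (insert a V) f (S \<union> T)" for f
        using fcoeff_insert_in[OF insert.hyps T(2,1), of f] unfolding half
        by (simp add: S'(1) p_def[abs_def])
      then show "coeff_prod V (m f) (m g) (S' \<union> T) = coeff_prod (insert a V) f g (S \<union> T)"
        by (simp add: coeff_prod_def)
    qed
    also have "V - S' = insert a V - S" using S' insert.hyps by auto
    finally show ?thesis .
  qed
qed

section \<open>The differential inequality\<close>

text \<open>Put \<open>y = F1 + W\<close> and \<open>w = 1 - K * s^2\<close>. Then
  \<open>y'' >= - K * y\<close> and \<open>w'' = - 2 * K <= - K * w\<close>, so the Wronskian
  \<open>?G = y' * w - y * w'\<close> grows from 0 and \<open>y / w\<close> is nondecreasing. Hence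
  \<open>y >= 2 * W * w\<close>, and \<open>w >= 3 / 4\<close> up to
  \<open>1 / (2 * sqrt K)\<close>.\<close>

lemma sturm_lower:
  fixes F1 F2 F3 :: "real \<Rightarrow> real"
  assumes d1: "\<And>t. (F1 has_real_derivative F2 t) (at t)"
    and d2: "\<And>t. (F2 has_real_derivative F3 t) (at t)"
    and W: "F1 0 = W" "0 < W" and F20: "F2 0 = 0" and K: "1 \<le> K"
    and nonneg: "\<And>t. 0 \<le> t \<Longrightarrow> t \<le> 1 / 2 \<Longrightarrow> 0 \<le> F1 t"
    and F3: "\<And>t. 0 \<le> t \<Longrightarrow> t \<le> 1 / 2 \<Longrightarrow> - K * (F1 t + W) \<le> F3 t"
    and t: "0 \<le> t" "t \<le> 1 / (2 * sqrt K)"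
  shows "W / 2 \<le> F1 t"
proof -
  have "1 \<le> sqrt K" using K by simp
  then have "1 / (2 * sqrt K) \<le> 1 / 2" by (intro divide_left_mono) auto
  with t have t2: "t \<le> 1 / 2" by simp
  have w: "K * s\<^sup>2 \<le> 1 / 4" if "0 \<le> s" "s \<le> t" for s
  proof -
    have "s\<^sup>2 \<le> (1 / (2 * sqrt K))\<^sup>2" using that t by (intro power_mono) auto
    then have "K * s\<^sup>2 \<le> K * (1 / (2 * sqrt K))\<^sup>2" using K by (intro mult_left_mono) auto
    also have "\<dots> = 1 / 4" using K by (simp add: power_divide power_mult_distrib)
    finally show ?thesis .
  qed
  let ?G = "\<lambda>s. F2 s * (1 - K * s\<^sup>2) + 2 * K * s * (F1 s + W)"
  have G: "0 \<le> ?G s" if s: "0 \<le> s" "s \<le> t" for s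
  proof -
    have "?G 0 \<le> ?G s"
    proof (rule DERIV_nonneg_imp_nondecreasing[of 0 s ?G])
      fix x assume x: "0 \<le> x" "x \<le> s"
      have xw: "K * x\<^sup>2 \<le> 1 / 4" using w x s by simp
      have "(?G has_real_derivative F3 x * (1 - K * x\<^sup>2) + 2 * K * (F1 x + W)) (at x)"
        by (auto intro!: derivative_eq_intros d1 d2 simp: algebra_simps)
      moreover have "0 \<le> F3 x * (1 - K * x\<^sup>2) + 2 * K * (F1 x + W)"
      proof -
        have "- K * (F1 x + W) * (1 - K * x\<^sup>2) \<le> F3 x * (1 - K * x\<^sup>2)"
          using F3[of x] x s t2 xw by (intro mult_right_mono) auto
        moreover have "0 \<le> K * (F1 x + W) * (1 + K * x\<^sup>2)"
          using nonneg[of x] x s t2 W K by simp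
        ultimately show ?thesis by (simp add: algebra_simps)
      qed
      ultimately show "\<exists>d. (?G has_real_derivative d) (at x) \<and> 0 \<le> d" by blast
    qed (use s in auto)
    then show ?thesis using F20 by simp
  qed
  let ?H = "\<lambda>s. (F1 s + W) / (1 - K * s\<^sup>2)"
  have "?H 0 \<le> ?H t"
  proof (rule DERIV_nonneg_imp_nondecreasing[of 0 t ?H])
    fix x assume x: "0 \<le> x" "x \<le> t"
    have xw: "K * x\<^sup>2 \<le> 1 / 4" using w x by simp
    then have nz: "1 - K * x\<^sup>2 \<noteq> 0" by simp
    have "(?H has_real_derivative ?G x / ((1 - K * x\<^sup>2) * (1 - K * x\<^sup>2))) (at x)"
      using nz by (auto intro!: derivative_eq_intros d1 simp: algebra_simps)
    moreover have "0 \<le> ?G x / ((1 - K * x\<^sup>2) * (1 - K * x\<^sup>2))"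
      using G[OF x] by (intro divide_nonneg_nonneg) auto
    ultimately show "\<exists>d. (?H has_real_derivative d) (at x) \<and> 0 \<le> d" by blast
  qed (use t in auto)
  then have "2 * W * (1 - K * t\<^sup>2) \<le> F1 t + W"
    using W w[of t] t by (simp add: pos_le_divide_eq)
  moreover have "2 * W * (3 / 4) \<le> 2 * W * (1 - K * t\<^sup>2)"
    using w[of t] t W by (intro mult_left_mono) auto
  ultimately show ?thesis by simp
qed

section \<open>Monotone restrictions, Parseval and antipodal symmetry\<close>

lemma mono_on_restr:
  assumes "mono_on (Pow V) f" "Z \<subseteq> V"
  shows "mono_on (Pow V) (restr R Z f)"
  unfolding restr_def using assms(2) by (intro monotone_onI monotone_onD[OF assms(1)]) auto

lemma fcoeff_singleton_nonneg:
  "finite V \<Longrightarrow> i \<in> V \<Longrightarrow> mono_on (Pow V) f \<Longrightarrow> 0 \<le> fcoeff V f {i}"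
  using uexp_mult_sg_nonneg by (simp add: fcoeff_def chi_def)

text \<open>The restriction formula for \<open>S = {}\<close> at \<rho> = 1: every coordinate is
  then frozen, so the restricted functions are the constants \<open>f Z\<close> and
  \<open>g Z\<close>.\<close>

lemma parseval:
  assumes "finite V"
  shows "uexp V (\<lambda>X. f X * g X) = set_poly V (coeff_prod V f g) 1"
proof -
  have "uexp V (\<lambda>Z. coeff_prod V (restr V Z f) (restr V Z g) {}) = uexp V (\<lambda>X. f X * g X)"
  proof (intro bexp_cong)
    fix Z assume Z: "Z \<subseteq> V"
    have "uexp V (restr V Z h) = uexp V (\<lambda>X. h Z)" for h
      using Z by (intro bexp_cong) (auto simp: restr_def Int_absorb2 intro!: arg_cong[where f = h])
    then show "coeff_prod V (restr V Z f) (restr V Z g) {} = f Z * g Z"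
      using assms by (simp add: coeff_prod_def)
  qed
  then show ?thesis using restriction_expectation[OF assms, of "{}" 1 f g] assms by simp
qed

text \<open>By Parseval, levels zero and one together weigh at most the mean \<open>p\<close> of
  \<open>f * f = f\<close>, so level one is at most the variance \<open>p - p^2\<close>.\<close>

lemma level1_le_quarter:
  assumes V: "finite V" and f: "\<And>X. X \<subseteq> V \<Longrightarrow> f X \<in> {0, 1}"
  shows "(\<Sum>i\<in>V. (fcoeff V f {i})\<^sup>2) \<le> 1 / 4"
proof -
  let ?c = "\<lambda>S. (fcoeff V f S)\<^sup>2"
  have "(\<Sum>i\<in>V. ?c {i}) + ?c {} = (\<Sum>S\<in>insert {} ((\<lambda>i. {i}) ` V). ?c S)"
    using V by (subst sum.insert) (auto simp: sum.reindex inj_on_def)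
  also have "\<dots> \<le> (\<Sum>S\<in>Pow V. ?c S)"
    using V by (intro sum_mono2) auto
  also have "\<dots> = uexp V (\<lambda>X. f X * f X)"
    using parseval[OF V, of f f] by (simp add: set_poly_1 coeff_prod_def power2_eq_square)
  also have "\<dots> = uexp V f" using f by (intro bexp_cong) fastforce
  finally have "(\<Sum>i\<in>V. ?c {i}) \<le> uexp V f - (uexp V f)\<^sup>2" by simp
  also have "\<dots> \<le> 1 / 4"
    using zero_le_power2[of "uexp V f - 1 / 2"] by (simp add: power2_eq_square algebra_simps)
  finally show ?thesis .
qed

text \<open>Complementation preserves the uniform measure and \<open>chi {i, j}\<close> while
  turning \<open>g\<close> into \<open>1 - g\<close>, so the coefficient equals its own
  negative.\<close>

lemma fcoeff_pair_antipodal: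
  assumes V: "finite V" and g: "\<And>X. X \<subseteq> V \<Longrightarrow> g X = 1 - g (V - X)"
    and ij: "i \<in> V" "j \<in> V" "i \<noteq> j"
  shows "fcoeff V g {i, j} = 0"
proof -
  have "fcoeff V g {i, j} = uexp V (\<lambda>X. g (V - X) * (sg i (V - X) * sg j (V - X)))"
    using uexp_compl[OF V, of "\<lambda>X. g X * (sg i X * sg j X)"] ij by (simp add: fcoeff_def chi_def)
  also have "\<dots> = uexp V (\<lambda>X. sg i X * sg j X - g X * (sg i X * sg j X))"
  proof (intro bexp_cong)
    fix X assume "X \<subseteq> V"
    then have gX: "g (V - X) = 1 - g X" using g[of X] by simp
    have s: "sg i (V - X) = - sg i X" "sg j (V - X) = - sg j X"
      using ij by (auto simp: sg_def)
    show "g (V - X) * (sg i (V - X) * sg j (V - X)) = sg i X * sg j X - g X * (sg i X * sg j X)"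
      unfolding gX s by (simp add: algebra_simps)
  qed
  also have "\<dots> = - fcoeff V g {i, j}"
    using ij V by (simp add: bexp_diff fcoeff_def chi_def)
  finally show ?thesis by simp
qed

section \<open>The interpolated correlation of two increasing functions\<close>

locale increasing_pair =
  fixes V :: "'a set" and f g :: "'a set \<Rightarrow> real"
  assumes finV: "finite V"
    and mono_f: "mono_on (Pow V) f" and mono_g: "mono_on (Pow V) g"
    and range_f: "\<And>X. X \<subseteq> V \<Longrightarrow> f X \<in> {0, 1}" and range_g: "\<And>X. X \<subseteq> V \<Longrightarrow> g X \<in> {0, 1}"
begin

abbreviation c where "c \<equiv> coeff_prod V f g"

text \<open>The noise stability polynomial \<open>q\<close>: for \<rho> in [0, 1] it is the
  expectation of \<open>f(x) * g(y)\<close> at \<rho>-correlated points. Its derivatives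
  \<open>F1\<close>, \<open>F2\<close>, \<open>F3\<close> are written as sums over ordered tuples of
  distinct indices, to match the restriction formula.\<close>

definition F0 where "F0 \<rho> = set_poly V c \<rho>"

definition F1 where "F1 \<rho> = (\<Sum>i\<in>V. set_poly (V - {i}) (\<lambda>T. c (insert i T)) \<rho>)"

definition F2 where
  "F2 \<rho> = (\<Sum>i\<in>V. \<Sum>j\<in>V - {i}. set_poly (V - {i} - {j}) (\<lambda>T. c (insert i (insert j T))) \<rho>)"

definition F3 where
  "F3 \<rho> = (\<Sum>i\<in>V. \<Sum>j\<in>V - {i}. \<Sum>l\<in>V - {i} - {j}.
      set_poly (V - {i} - {j} - {l}) (\<lambda>T. c (insert i (insert j (insert l T)))) \<rho>)"

definition W where "W = (\<Sum>i\<in>V. c {i})"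

lemma F0_deriv: "(F0 has_real_derivative F1 \<rho>) (at \<rho>)"
  unfolding F0_def[abs_def] F1_def using has_real_derivative_set_poly[OF finV] .

lemma F1_deriv: "(F1 has_real_derivative F2 \<rho>) (at \<rho>)"
  unfolding F1_def[abs_def] F2_def using finV by (intro DERIV_sum has_real_derivative_set_poly) auto

lemma F2_deriv: "(F2 has_real_derivative F3 \<rho>) (at \<rho>)"
  unfolding F2_def[abs_def] F3_def using finV by (intro DERIV_sum has_real_derivative_set_poly) auto

lemma covariance: "F0 1 - F0 0 = uexp V (\<lambda>X. f X * g X) - uexp V f * uexp V g"
  using finV by (simp add: F0_def parseval coeff_prod_def)

lemma F1_0: "F1 0 = W"
  using finV by (simp add: F1_def W_def)

lemma W_nonneg: "0 \<le> W"
  unfolding W_def coeff_prod_def using finV mono_f mono_g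
  by (intro sum_nonneg mult_nonneg_nonneg fcoeff_singleton_nonneg)

lemma W_le: "W \<le> 1 / 4"
proof -
  have "W \<le> (\<Sum>i\<in>V. ((fcoeff V f {i})\<^sup>2 + (fcoeff V g {i})\<^sup>2) / 2)"
    unfolding W_def coeff_prod_def
  proof (intro sum_mono)
    fix i
    show "fcoeff V f {i} * fcoeff V g {i} \<le> ((fcoeff V f {i})\<^sup>2 + (fcoeff V g {i})\<^sup>2) / 2"
      using zero_le_power2[of "fcoeff V f {i} - fcoeff V g {i}"] by (simp add: power2_diff)
  qed
  also have "\<dots> = ((\<Sum>i\<in>V. (fcoeff V f {i})\<^sup>2) + (\<Sum>i\<in>V. (fcoeff V g {i})\<^sup>2)) / 2"
    by (simp add: sum.distrib flip: sum_divide_distrib)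
  also have "\<dots> \<le> 1 / 4"
    using level1_le_quarter[of V f, OF finV range_f] level1_le_quarter[of V g, OF finV range_g] by simp
  finally show ?thesis .
qed

text \<open>The factor is the probability that the index \<open>i\<close> stays free. As
  restrictions of increasing functions are increasing, this transports first-level positivity to
  \<open>F1\<close> on [0, 1).\<close>

lemma restricted_level1:
  "bexp \<rho> V (\<lambda>R. uexp V (\<lambda>Z. \<Sum>i\<in>V. coeff_prod V (restr R Z f) (restr R Z g) {i})) = (1 - \<rho>) * F1 \<rho>"
  unfolding bexp_sum F1_def sum_distrib_left
  using finV by (intro sum.cong refl) (simp add: restriction_expectation)

lemma restricted_level3:
  "bexp \<rho> V (\<lambda>R. uexp V (\<lambda>Z. \<Sum>i\<in>V. \<Sum>j\<in>V - {i}. \<Sum>l\<in>V - {i, j}. coeff_prod V (restr R Z f) (restr R Z g) {i, j, l}))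
    = (1 - \<rho>) ^ 3 * F3 \<rho>"
  unfolding bexp_sum F3_def sum_distrib_left
proof (intro sum.cong refl)
  fix i j assume "i \<in> V" "j \<in> V - {i}"
  show "V - {i, j} = V - {i} - {j}" by auto
next
  fix i j l assume *: "i \<in> V" "j \<in> V - {i}" "l \<in> V - {i} - {j}"
  then have "card {i, j, l} = 3" "V - {i, j, l} = V - {i} - {j} - {l}" by auto
  with * show "bexp \<rho> V (\<lambda>R. uexp V (\<lambda>Z. coeff_prod V (restr R Z f) (restr R Z g) {i, j, l}))
    = (1 - \<rho>) ^ 3 * set_poly (V - {i} - {j} - {l}) (\<lambda>T. c (insert i (insert j (insert l T)))) \<rho>"
    using restriction_expectation[OF finV, of "{i, j, l}" \<rho> f g] by simp
qed

lemma F1_nonneg: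
  assumes "0 \<le> \<rho>" "\<rho> < 1"
  shows "0 \<le> F1 \<rho>"
proof -
  have "0 \<le> (1 - \<rho>) * F1 \<rho>"
    unfolding restricted_level1[symmetric] coeff_prod_def
    using assms finV mono_f mono_g
    by (intro bexp_nonneg sum_nonneg mult_nonneg_nonneg fcoeff_singleton_nonneg mono_on_restr) auto
  then show ?thesis using assms by (simp add: zero_le_mult_iff)
qed

lemma F0_mono:
  assumes "0 \<le> a" "a \<le> 1"
  shows "F0 a \<le> F0 1"
\<comment> \<open>The sign of the derivative is known only below 1, so the right endpoint is reached
  by continuity.\<close>
proof (rule DERIV_nonneg_imp_increasing_open[of a 1 F0])
  show "a \<le> 1" by fact
  show "\<exists>y. (F0 has_real_derivative y) (at x) \<and> 0 \<le> y" if "a < x" "x < 1" for x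
    using F0_deriv F1_nonneg[of x] that assms by (intro exI[of _ "F1 x"]) auto
  show "continuous_on {a..1} F0"
    using DERIV_isCont[OF F0_deriv] by (intro continuous_at_imp_continuous_on) auto
qed

lemma covariance_nonneg: "0 \<le> uexp V (\<lambda>X. f X * g X) - uexp V f * uexp V g"
  using F0_mono[of 0] covariance by simp

text \<open>The third-level bound is applied to every restriction with tangent parameter
  \<open>v = W\<close> and then averaged; this choice makes the coefficient of order
  \<open>1 - ln W\<close>.\<close>

lemma F3_lower:
  assumes W: "0 < W" and \<rho>: "0 \<le> \<rho>" "\<rho> \<le> 1 / 2"
  shows "- (512 * (1 - ln W)) * (F1 \<rho> + W) \<le> F3 \<rho>"
proof -
  have W1: "W \<le> 1" using W_le by simp
  have lnW: "ln W \<le> 0" using W W1 by simp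
  have F1: "0 \<le> F1 \<rho>" using F1_nonneg \<rho> by simp
  have "- 64 * W + 32 * ((1 - \<rho>) * F1 \<rho>) * ln W
      = bexp \<rho> V (\<lambda>R. uexp V (\<lambda>Z. - 64 * W + 32 * (\<Sum>i\<in>V. coeff_prod V (restr R Z f) (restr R Z g) {i}) * ln W))"
    by (simp only: bexp_add bexp_const[OF finV] bexp_multc bexp_cmult restricted_level1)
  also have "\<dots> \<le> bexp \<rho> V (\<lambda>R. uexp V (\<lambda>Z. \<Sum>i\<in>V. \<Sum>j\<in>V - {i}. \<Sum>l\<in>V - {i, j}. coeff_prod V (restr R Z f) (restr R Z g) {i, j, l}))"
  proof (intro bexp_mono third_level_lower finV mono_on_restr mono_f mono_g W)
    fix R Z X assume "R \<subseteq> V" "Z \<subseteq> V" "X \<subseteq> V"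
    then have "Z \<inter> R \<union> (X - R) \<subseteq> V" by auto
    from range_f[OF this] range_g[OF this]
    show "\<bar>restr R Z f X\<bar> \<le> 1" "\<bar>restr R Z g X\<bar> \<le> 1"
      unfolding restr_def by auto
  qed (use \<rho> in auto)
  also have "\<dots> = (1 - \<rho>) ^ 3 * F3 \<rho>" by (rule restricted_level3)
  finally have "- 64 * W + 32 * ((1 - \<rho>) * F1 \<rho>) * ln W \<le> (1 - \<rho>) ^ 3 * F3 \<rho>" .
  moreover have "F1 \<rho> * ln W \<le> ((1 - \<rho>) * F1 \<rho>) * ln W"
    using \<rho> F1 lnW by (intro mult_right_mono_neg) (auto simp: algebra_simps)
  ultimately have low: "- 64 * W + 32 * (F1 \<rho> * ln W) \<le> (1 - \<rho>) ^ 3 * F3 \<rho>"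
    by linarith
  have lnF: "F1 \<rho> * ln W \<le> 0" and lnWW: "W * ln W \<le> 0"
    using F1 lnW W by (auto intro: mult_nonneg_nonpos)
  \<comment> \<open>For negative \<open>F3 \<rho>\<close> the factor
    \<open>(1 - \<rho>) ^ 3\<close>, at least 1/8, is removed at the cost of multiplying 64 and 32
    by 8.\<close>
  have goal: "- 512 * W + 256 * (F1 \<rho> * ln W) \<le> F3 \<rho>"
  proof (cases "0 \<le> F3 \<rho>")
    case True
    then show ?thesis using lnF W by linarith
  next
    case False
    have "(1 / 2) ^ 3 \<le> (1 - \<rho>) ^ 3" using \<rho> by (intro power_mono) auto
    then have "(1 - \<rho>) ^ 3 * F3 \<rho> \<le> (1 / 2) ^ 3 * F3 \<rho>"
      using False by (intro mult_right_mono_neg) auto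
    with low show ?thesis by (simp add: power3_eq_cube)
  qed
  have "- (512 * (1 - ln W)) * (F1 \<rho> + W)
      = - 512 * W + 512 * (F1 \<rho> * ln W) - 512 * F1 \<rho> + 512 * (W * ln W)"
    by (simp add: algebra_simps)
  then show ?thesis using goal lnF lnWW F1 by linarith
qed

text \<open>Sturm comparison keeps \<open>F1\<close> above \<open>W / 2\<close> on an initial
  interval of length \<open>1 / (2 * sqrt K)\<close>; integration gives
  \<open>W / (4 * sqrt K)\<close>, and \<open>F0 1\<close> is no smaller than the value reached
  there.\<close>

lemma covariance_lower:
  assumes W: "0 < W" and anti: "\<And>X. X \<subseteq> V \<Longrightarrow> g X = 1 - g (V - X)"
  shows "W / (4 * sqrt (512 * (1 - ln W))) \<le> uexp V (\<lambda>X. f X * g X) - uexp V f * uexp V g"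
proof -
  define K where "K = 512 * (1 - ln W)"
  define t0 where "t0 = 1 / (2 * sqrt K)"
  have "ln W \<le> 0" using W W_le by simp
  then have K: "1 \<le> K" by (simp add: K_def)
  have t0: "0 \<le> t0" "t0 \<le> 1"
    using K by (auto simp: t0_def divide_le_eq intro: order_trans[of 1 "sqrt K"])
  \<comment> \<open>\<open>F2 0\<close> is the sum over ordered pairs of products of level-two
    coefficients, which antipodality of \<open>g\<close> kills.\<close>
  have "fcoeff V g {i, j} = 0" if "i \<in> V" "j \<in> V \<and> j \<noteq> i" for i j
    using that by (intro fcoeff_pair_antipodal finV anti) auto
  then have F20: "F2 0 = 0"
    using finV by (simp add: F2_def coeff_prod_def)
  have low: "W / 2 \<le> F1 t" if "0 \<le> t" "t \<le> t0" for t
    using that F1_nonneg F3_lower[OF W] unfolding K_def[symmetric] t0_def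
    by (intro sturm_lower[of F1 F2 F3 W K] F1_deriv F2_deriv F1_0 W F20 K) auto
  have "F0 0 - W / 2 * 0 \<le> F0 t0 - W / 2 * t0"
  proof (rule DERIV_nonneg_imp_nondecreasing[of 0 t0 "\<lambda>t. F0 t - W / 2 * t"])
    fix x assume "0 \<le> x" "x \<le> t0"
    then have "0 \<le> F1 x - W / 2" using low by simp
    moreover have "((\<lambda>t. F0 t - W / 2 * t) has_real_derivative F1 x - W / 2) (at x)"
      by (auto intro!: derivative_eq_intros F0_deriv)
    ultimately show "\<exists>y. ((\<lambda>t. F0 t - W / 2 * t) has_real_derivative y) (at x) \<and> 0 \<le> y" by blast
  qed (rule t0)
  then have "W / 2 * t0 \<le> F0 1 - F0 0" using F0_mono[OF t0] by simp
  then show ?thesis by (simp add: covariance t0_def K_def)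
qed

end

section \<open>Transfer to the cube of sign vectors\<close>

lemma mono_on_PowI:
  fixes F :: "'a set \<Rightarrow> real"
  assumes "finite V" and step: "\<And>X i. X \<subseteq> V \<Longrightarrow> i \<in> V \<Longrightarrow> i \<notin> X \<Longrightarrow> F X \<le> F (insert i X)"
  shows "mono_on (Pow V) F"
proof (rule monotone_onI)
  fix X Y :: "'a set"
  assume "X \<in> Pow V" "Y \<in> Pow V" "X \<le> Y"
  have "F X \<le> F (X \<union> D)" if "finite D" "D \<subseteq> V" "D \<inter> X = {}" for D
    using that
  proof (induction D rule: finite_induct)
    case (insert i D)
    have "F (X \<union> D) \<le> F (insert i (X \<union> D))"
      using insert \<open>X \<in> Pow V\<close> by (intro step) auto
    with insert show ?case by auto
  qed simp
  from this[of "Y - X"] show "F X \<le> F Y"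
    using \<open>finite V\<close> \<open>Y \<in> Pow V\<close> \<open>X \<le> Y\<close> by (auto simp: Un_absorb1 finite_subset)
qed

section \<open>Identification of sign vectors with subsets\<close>

lemma uexp_eq_average:
  assumes "finite V"
  shows "uexp V F = (\<Sum>X\<in>Pow V. F X) / 2 ^ card V"
proof -
  have "(1 / 2) ^ card X * (1 - 1 / 2) ^ card (V - X) = 1 / (2::real) ^ card V" if "X \<in> Pow V" for X
  proof -
    have "card X + card (V - X) = card V"
      using that assms by (simp add: card_Diff_subset card_mono finite_subset)
    then show ?thesis by (simp add: power_one_over flip: power_add)
  qed
  then show ?thesis unfolding bexp_def sum_divide_distrib by (intro sum.cong refl) simp
qed

definition cube_point :: "nat \<Rightarrow> nat set \<Rightarrow> nat \<Rightarrow> int" where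
  "cube_point n X = (\<lambda>i\<in>{1..n}. if i \<in> X then 1 else - 1)"

lemma bij_betw_cube_point: "bij_betw (cube_point n) (Pow {1..n}) (cube n)"
proof (rule bij_betw_byWitness[where f' = "\<lambda>x. {i\<in>{1..n}. x i = 1}"])
  show "\<forall>X\<in>Pow {1..n}. {i \<in> {1..n}. cube_point n X i = 1} = X"
    by (auto simp: cube_point_def split: if_splits)
  show "\<forall>x\<in>cube n. cube_point n {i \<in> {1..n}. x i = 1} = x"
  proof
    fix x assume "x \<in> cube n"
    then have u: "x \<in> extensional {1..n}" and x: "\<And>i. i \<in> {1..n} \<Longrightarrow> x i \<in> {- 1, 1}"
      by (auto simp: cube_def PiE_def Pi_def)
    show "cube_point n {i \<in> {1..n}. x i = 1} = x"
    proof (rule extensionalityI[OF _ u])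
      fix i assume "i \<in> {1..n}"
      with x[OF this] show "cube_point n {i \<in> {1..n}. x i = 1} i = x i" by (auto simp: cube_point_def)
    qed (simp add: cube_point_def)
  qed
  show "cube_point n ` Pow {1..n} \<subseteq> cube n"
    by (auto simp: cube_point_def cube_def PiE_def Pi_def)
  show "(\<lambda>x. {i \<in> {1..n}. x i = 1}) ` cube n \<subseteq> Pow {1..n}" by auto
qed

lemma cube_point_in_cube [simp]: "X \<subseteq> {1..n} \<Longrightarrow> cube_point n X \<in> cube n"
  using bij_betw_cube_point by (auto simp: bij_betw_def)

lemma cube_expectation_eq_uexp: "cube_expectation n F = uexp {1..n} (\<lambda>X. F (cube_point n X))"
proof -
  have fin: "finite (cube n)" "card (cube n) = 2 ^ n"
    using bij_betw_finite[OF bij_betw_cube_point[of n]] bij_betw_same_card[OF bij_betw_cube_point[of n]]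
    by (auto simp: card_Pow)
  then have "cube n \<noteq> {}" by auto
  then have "cube_expectation n F = sum F (cube n) / 2 ^ n"
    unfolding cube_measure_def using fin by (simp add: integral_pmf_of_set)
  also have "sum F (cube n) = (\<Sum>X\<in>Pow {1..n}. F (cube_point n X))"
    using sum.reindex_bij_betw[OF bij_betw_cube_point] by metis
  finally show ?thesis by (simp add: uexp_eq_average)
qed

lemma discrete_deriv_cube_point:
  assumes "i \<in> {1..n}"
  shows "discrete_deriv i f (cube_point n X) = f (cube_point n (insert i X)) - f (cube_point n (X - {i}))"
proof -
  have "(cube_point n X)(i := 1) = cube_point n (insert i X)"
    "(cube_point n X)(i := - 1) = cube_point n (X - {i})"
    using assms by (auto simp: cube_point_def)
  then show ?thesis by (simp add: discrete_deriv_def)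
qed

lemma antipode_cube_point: "antipode n (cube_point n X) = cube_point n ({1..n} - X)"
  by (auto simp: antipode_def cube_point_def)

lemma fcoeff_singleton_eq_deriv:
  assumes "finite V" "i \<in> V"
  shows "fcoeff V f {i} = uexp V (\<lambda>X. f (insert i X) - f (X - {i})) / 2"
proof -
  define V' where "V' = V - {i}"
  have V: "V = insert i V'" "i \<notin> V'" "finite V'" using assms by (auto simp: V'_def)
  have "uexp V' (\<lambda>X. f (insert i X) - f (X - {i})) = uexp V' (\<lambda>X. f (insert i X) - f X)"
    "uexp V' (\<lambda>X. f (insert i X) - f (insert i X - {i})) = uexp V' (\<lambda>X. f (insert i X) - f X)"
    using V(2) by (auto intro!: bexp_cong arg_cong[where f = f])
  then have "uexp V (\<lambda>X. f (insert i X) - f (X - {i})) = uexp V' (\<lambda>X. f (insert i X) - f X)"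
    unfolding V(1) bexp_insert[OF V(3,2)] by simp
  moreover have "fcoeff V f {i} = (uexp V' (\<lambda>X. f (insert i X)) - uexp V' f) / 2"
    unfolding V(1) using fcoeff_insert_in[OF V(3,2), of "{}"] by simp
  ultimately show ?thesis by (simp add: bexp_diff)
qed

lemma mono_on_cube_increasing:
  assumes "cube_increasing n f"
  shows "mono_on (Pow {1..n}) (\<lambda>X. f (cube_point n X))"
proof (rule mono_on_PowI)
  fix X i assume X: "X \<subseteq> {1..n}" "i \<in> {1..n}" "i \<notin> X"
  then have "0 \<le> discrete_deriv i f (cube_point n X)"
    using assms by (simp add: cube_increasing_def)
  with X show "f (cube_point n X) \<le> f (cube_point n (insert i X))"
    by (simp add: discrete_deriv_cube_point)
qed simp

text \<open>One factor 2 is in the definition of the influence; the other arises because the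
  coefficient is half the mean derivative.\<close>

lemma influence_eq_fcoeff:
  assumes "cube_increasing n f" "i \<in> {1..n}"
  shows "influence n i f = 4 * fcoeff {1..n} (\<lambda>X. f (cube_point n X)) {i}"
proof -
  have "uexp {1..n} (\<lambda>X. \<bar>discrete_deriv i f (cube_point n X)\<bar>)
      = uexp {1..n} (\<lambda>X. f (cube_point n (insert i X)) - f (cube_point n (X - {i})))"
    using assms by (intro bexp_cong) (simp add: cube_increasing_def flip: discrete_deriv_cube_point)
  then show ?thesis
    using assms by (simp add: influence_def cube_expectation_eq_uexp fcoeff_singleton_eq_deriv)
qed

theorem theorem2:
  "\<exists>c::real. c > 0 \<and>
     (\<forall>n\<ge>1. \<forall>f \<in> cube n \<rightarrow> {0, 1}. \<forall>g \<in> cube n \<rightarrow> {0, 1}.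
        cube_increasing n f \<longrightarrow> cube_increasing n g \<longrightarrow> antipodal n g \<longrightarrow>
        (let S = (\<Sum>i=1..n. influence n i f * influence n i g)
         in Cor n f g \<ge> (if S = 0 then 0 else c * (S / sqrt (ln (2 * exp 1 / S))))))"
proof (intro exI conjI allI ballI impI)
  \<comment> \<open>Here \<open>64 = 4 * 16\<close> and \<open>5120 = 512 * 10\<close>: 16 is the
    ratio of \<open>S\<close> to \<open>W\<close>, 4 and 512 come from the correlation bound, and 10
    from \<open>L <= 10 * M\<close> below.\<close>
  show "1 / (64 * sqrt 5120) > (0::real)" by simp
next
  fix n :: nat and f g :: "(nat \<Rightarrow> int) \<Rightarrow> real"
  assume f: "f \<in> cube n \<rightarrow> {0, 1}" and g: "g \<in> cube n \<rightarrow> {0, 1}"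
    and inc: "cube_increasing n f" "cube_increasing n g" and anti: "antipodal n g"
  let ?V = "{1..n}"
  define F where "F X = f (cube_point n X)" for X
  define G where "G X = g (cube_point n X)" for X
  define S where "S = (\<Sum>i=1..n. influence n i f * influence n i g)"
  interpret increasing_pair ?V F G
  proof
    show "mono_on (Pow ?V) F" "mono_on (Pow ?V) G"
      unfolding F_def[abs_def] G_def[abs_def] by (intro mono_on_cube_increasing inc)+
    fix X assume "X \<subseteq> ?V"
    then have "cube_point n X \<in> cube n" by simp
    then show "F X \<in> {0, 1}" "G X \<in> {0, 1}"
      unfolding F_def G_def by (rule Pi_mem[OF f], rule Pi_mem[OF g])
  qed simp
  have S: "S = 16 * W"
    unfolding S_def W_def coeff_prod_def sum_distrib_left
    by (intro sum.cong refl) (simp add: influence_eq_fcoeff inc F_def[abs_def] G_def[abs_def])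
  have Cor: "Cor n f g = uexp ?V (\<lambda>X. F X * G X) - uexp ?V F * uexp ?V G"
    by (simp add: Cor_def cube_expectation_eq_uexp F_def[abs_def] G_def[abs_def])
  have anti': "G X = 1 - G (?V - X)" if "X \<subseteq> ?V" for X
    using anti[unfolded antipodal_def, rule_format, OF cube_point_in_cube[OF that]]
    by (simp add: G_def antipode_cube_point)
  have "Cor n f g \<ge> 1 / (64 * sqrt 5120) * (S / sqrt (ln (2 * exp 1 / S)))" if "S \<noteq> 0"
  proof -
    have W: "0 < W" using that W_nonneg S by simp
    define L where "L = 1 - ln W"
    define M where "M = ln (2 * exp 1 / S)"
    have ln8: "ln (8::real) = 3 * ln 2" and ln4: "ln (1 / 4::real) = - 2 * ln 2"
      using ln_realpow[of "2::real" 3] ln_realpow[of "2::real" 2] by (simp_all add: ln_div)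
    have "ln W \<le> ln (1 / 4)" using W W_le by (intro ln_mono) auto
    then have "ln W \<le> - 2 * ln 2" unfolding ln4 .
    moreover have "2 * exp 1 / S = exp 1 / (8 * W)" by (simp add: S)
    then have M: "M = L - 3 * ln 2" using W ln8 by (simp add: M_def L_def ln_div ln_mult)
    \<comment> \<open>From \<open>W <= 1 / 4\<close>, \<open>L >= 1 + 2 * ln 2\<close>. With
      \<open>M = L - 3 * ln 2\<close> this yields \<open>M >= 1 - ln 2 > 0\<close>, and
      \<open>L <= 10 * M\<close> follows from \<open>12 * ln 2 <= 9\<close>.\<close>
    moreover have "0 \<le> ln (2::real)" "ln (2::real) \<le> 25 / 36" using ln2_le_25_over_36 by auto
    ultimately have LM: "0 < M" "L \<le> 10 * M" and L: "0 < L" unfolding L_def by linarith+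
    have "1 / (64 * sqrt 5120) * (S / sqrt M) = W / (4 * sqrt (512 * (10 * M)))"
      by (simp add: S real_sqrt_mult[symmetric])
    also have "\<dots> \<le> W / (4 * sqrt (512 * L))"
      using W LM L by (intro divide_left_mono mult_left_mono real_sqrt_le_mono) auto
    also have "\<dots> \<le> Cor n f g"
      using covariance_lower[OF W anti'] by (simp add: Cor L_def)
    finally show ?thesis by (simp add: M_def)
  qed
  moreover have "0 \<le> Cor n f g" using covariance_nonneg by (simp add: Cor)
  ultimately show "let S = (\<Sum>i=1..n. influence n i f * influence n i g)
         in Cor n f g \<ge> (if S = 0 then 0 else 1 / (64 * sqrt 5120) * (S / sqrt (ln (2 * exp 1 / S))))"
    unfolding Let_def S_def[symmetric] by presburger
qed

end
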